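(* Let $\alpha\in I(\mathcal A)$ and fix a choice $\hat\rho$ of one of the roots of $f(x;t)$ on $\mathcal U$. Then the functions $\Phi^{\mathcal A}(\alpha)$ and $\tau_\rho(\alpha)$, where $\rho$ runs over all the roots of $f(x;t)$ on $\mathcal U$ different from $\hat\rho$, are linearly independent $\mathcal A$-hypergeometric functions with exponent $\alpha$.
   Context: Setting: $m\ge 1$ and $0<k_1<\dots<k_m<d$ are integers with $\gcd(k_1,\dots,k_m,d)=1$; $\Lambda=\{0,k_1,\dots,k_m,d\}$, and all $(m+2)$-tuples are indexed by $\Lambda$. $\mathbb N=\{0,1,2,\dots\}$. $\mathcal A$ is the $2\times(m+2)$ integer matrix whose columns are $(1,j)^T$, $j\in\Lambda$. Variables $x=(x_j)_{j\in\Lambda}\in\mathbb C^{m+2}$. $I(\mathcal A)=\mathcal A\cdot\mathbb N^{\Lambda}\subset\mathbb Z^2$. The $\mathcal A$-hypergeometric system with exponent $\alpha=(\alpha_1,\alpha_2)$ consists of the equations $\prod_{v_j>0}(\partial/\partial x_j)^{v_j}\varphi=\prod_{v_j<0}(\partial/\partial x_j)^{-v_j}\varphi$ for all $v\in\mathbb Z^{\Lambda}$ with $\mathcal A v=0$, together with $\sum_{j}x_j\,\partial\varphi/\partial x_j=\alpha_1\varphi$ and $\sum_{j}j\,x_j\,\partial\varphi/\partial x_j=\alpha_2\varphi$; its solutions are called $\mathcal A$-hypergeometric functions with exponent $\alpha$. Let $f(x;t)=\sum_{j\in\Lambda}x_jt^j$, and let $\Sigma\subset\mathbb C^{m+2}$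 be the set where $x_0=0$, or $x_d=0$, or the discriminant of $f(x;t)$ (as a polynomial in $t$) vanishes. $\mathcal U\subset\mathbb C^{m+2}\setminus\Sigma$ is a nonempty simply-connected open set, on which $f(x;t)$ has $d$ distinct holomorphic nowhere-vanishing roots. The hypergeometric polynomial is $\Phi^{\mathcal A}(\beta)=\Phi^{\mathcal A}(\beta;x)=\sum_{u\in\mathbb N^{\Lambda},\,\mathcal A u=\beta}\prod_j x_j^{u_j}/u_j!$ (zero if $\beta\notin I(\mathcal A)$). For $\alpha=(\alpha_1,\alpha_2)\in I(\mathcal A)$ and a root $\rho\neq\hat\rho$, $$\tau_\rho(\alpha)=\sum_{0\le i\le d\alpha_1,\ i\ne\alpha_2}\Phi^{\mathcal A}((\alpha_1,i))\,\frac{\rho^{\,i-\alpha_2}-\hat\rho^{\,i-\alpha_2}}{i-\alpha_2}+\Phi^{\mathcal A}(\alpha)\log(\rho/\hat\rho),$$ with a fixed holomorphic branch of $\log(\rho/\hat\rho)$ on $\mathcal U$. *)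

theory Defs
  imports
    "Subresultants.Resultant_Prelim"
    "HOL-Analysis.Analysis"
begin

no_notation Matrix.vec_index (infixl "$" 100)
hide_const (open) Matrix.vec Matrix.mat Matrix.row Determinant.det

text \<open>
  The index set \<open>\<Lambda> = {0 < k\<^sub>1 < \<dots> < k\<^sub>m < d}\<close> is presented as the range of a strictly
  monotone map \<open>k\<close> from a finite linearly ordered type \<open>'n\<close> with \<open>m + 2\<close> elements, so
  that \<open>\<Lambda>\<close>-tuples are vectors of type \<open>_ ^ 'n\<close>.
\<close>

definition exponents :: "('n::{finite,linorder} \<Rightarrow> nat) \<Rightarrow> nat \<Rightarrow> bool" where
  "exponents k d \<longleftrightarrow> 3 \<le> CARD('n) \<and> strict_mono k \<and> k (Min UNIV) = 0 \<and> k (Max UNIV) = d \<and>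
     Gcd (range k) = 1"

definition mat_A :: "('n::finite \<Rightarrow> nat) \<Rightarrow> int ^ 'n ^ 2" where
  "mat_A k = vector [\<chi> j. 1, \<chi> j. int (k j)]"

definition I_A :: "('n::finite \<Rightarrow> nat) \<Rightarrow> (int ^ 2) set" where
  "I_A k = {mat_A k *v (\<chi> j. int (u $ j)) | u :: nat ^ 'n. True}"

text \<open>
  Holomorphic functions of several variables: the real Frechet derivative is complex linear.
\<close>

definition holo_on :: "(complex ^ 'n \<Rightarrow> complex) \<Rightarrow> (complex ^ 'n) set \<Rightarrow> bool" where
  "holo_on \<phi> U \<longleftrightarrow> (\<forall>x\<in>U. \<exists>D. (\<phi> has_derivative D) (at x within U) \<and>
     (\<forall>c v. D (c *s v) = c * D v))"

definition pd :: "'n \<Rightarrow> (complex ^ 'n \<Rightarrow> complex) \<Rightarrow> complex ^ 'n \<Rightarrow> complex" where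
  "pd j \<phi> x = deriv (\<lambda>z. \<phi> (\<chi> i. if i = j then z else x $ i)) (x $ j)"

text \<open>
  \<open>\<Prod>\<^sub>j (\<partial>/\<partial>x\<^sub>j)\<^bsup>n j\<^esup>\<close>, applied in increasing order of \<open>j\<close>; the order is
  immaterial for holomorphic functions, whose partial derivatives commute.
\<close>

definition mpd :: "('n::{finite,linorder} \<Rightarrow> nat) \<Rightarrow> (complex ^ 'n::{finite,linorder} \<Rightarrow> complex)
    \<Rightarrow> complex ^ 'n::{finite,linorder} \<Rightarrow> complex" where
  "mpd n \<phi> = fold (\<lambda>j. pd j ^^ n j) (sorted_list_of_set UNIV) \<phi>"

definition A_hypergeometric_on ::
    "('n::{finite,linorder} \<Rightarrow> nat) \<Rightarrow> (complex ^ 'n::{finite,linorder}) set \<Rightarrow> complex ^ 2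
      \<Rightarrow> (complex ^ 'n::{finite,linorder} \<Rightarrow> complex) \<Rightarrow> bool" where
  "A_hypergeometric_on k U \<alpha> \<phi> \<longleftrightarrow> holo_on \<phi> U \<and>
     (\<forall>v :: int ^ 'n::{finite,linorder}. mat_A k *v v = 0 \<longrightarrow>
        (\<forall>x\<in>U. mpd (\<lambda>j. nat (v $ j)) \<phi> x = mpd (\<lambda>j. nat (- v $ j)) \<phi> x)) \<and>
     (\<forall>x\<in>U. (\<Sum>j\<in>UNIV. x $ j * pd j \<phi> x) = \<alpha> $ 1 * \<phi> x) \<and>
     (\<forall>x\<in>U. (\<Sum>j\<in>UNIV. of_nat (k j) * x $ j * pd j \<phi> x) = \<alpha> $ 2 * \<phi> x)"

definition f_poly :: "('n::finite \<Rightarrow> nat) \<Rightarrow> complex ^ 'n \<Rightarrow> complex poly" where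
  "f_poly k x = (\<Sum>j\<in>UNIV. monom (x $ j) (k j))"

definition discriminant :: "complex poly \<Rightarrow> complex" where
  "discriminant p = (- 1) ^ (degree p * (degree p - 1) div 2) * resultant p (pderiv p)
     / lead_coeff p"

text \<open>
  \<open>discriminant (f_poly k x)\<close> refers to the actual degree of \<open>f\<close>, which may differ from
  \<open>d\<close> only if \<open>x\<^sub>d = 0\<close>; such points belong to \<open>\<Sigma>\<close> anyway.
\<close>

definition Sigma_set :: "('n::{finite,linorder} \<Rightarrow> nat) \<Rightarrow> (complex ^ 'n::{finite,linorder}) set" where
  "Sigma_set k = {x. x $ Min UNIV = 0 \<or> x $ Max UNIV = 0 \<or> discriminant (f_poly k x) = 0}"

text \<open>
  Root functions on \<open>U\<close> are taken extensional (undefined off \<open>U\<close>), so that equality of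
  them is equality on \<open>U\<close>. For simply connected open \<open>U\<close> off \<open>\<Sigma>\<close> there are exactly \<open>d\<close> of
  them, they are pairwise distinct at every point of \<open>U\<close>, and they vanish nowhere on \<open>U\<close>.
\<close>

definition roots_on :: "('n::finite \<Rightarrow> nat) \<Rightarrow> (complex ^ 'n) set \<Rightarrow> (complex ^ 'n \<Rightarrow> complex) set" where
  "roots_on k U = {\<rho> \<in> extensional U. holo_on \<rho> U \<and> (\<forall>x\<in>U. poly (f_poly k x) (\<rho> x) = 0)}"

definition Phi :: "('n::finite \<Rightarrow> nat) \<Rightarrow> int ^ 2 \<Rightarrow> complex ^ 'n \<Rightarrow> complex" where
  "Phi k \<beta> x = (\<Sum>u | mat_A k *v (\<chi> j. int (u $ j)) = \<beta>. \<Prod>j\<in>UNIV. x $ j ^ (u $ j) / fact (u $ j))"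

text \<open>\<open>lg\<close> is the chosen branch of \<open>log (\<rho> / \<rho>')\<close>, where \<open>\<rho>'\<close> is the distinguished root.\<close>

definition log_branch_on :: "(complex ^ 'n) set \<Rightarrow> (complex ^ 'n \<Rightarrow> complex)
    \<Rightarrow> (complex ^ 'n \<Rightarrow> complex) \<Rightarrow> (complex ^ 'n \<Rightarrow> complex) \<Rightarrow> bool" where
  "log_branch_on U \<rho>' \<rho> lg \<longleftrightarrow> holo_on lg U \<and> (\<forall>x\<in>U. exp (lg x) = \<rho> x / \<rho>' x)"

definition tau :: "('n::finite \<Rightarrow> nat) \<Rightarrow> nat \<Rightarrow> int ^ 2 \<Rightarrow> (complex ^ 'n \<Rightarrow> complex)
    \<Rightarrow> (complex ^ 'n \<Rightarrow> complex) \<Rightarrow> (complex ^ 'n \<Rightarrow> complex) \<Rightarrow> complex ^ 'n \<Rightarrow> complex" where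
  "tau k d \<alpha> \<rho>' \<rho> lg x =
     (\<Sum>i \<in> {0 .. int d * \<alpha> $ 1} - {\<alpha> $ 2}.
        Phi k (vector [\<alpha> $ 1, i]) x *
        ((\<rho> x powi (i - \<alpha> $ 2) - \<rho>' x powi (i - \<alpha> $ 2)) / of_int (i - \<alpha> $ 2)))
     + Phi k \<alpha> x * lg x"

text \<open>
  Linear independence over the complex numbers of a family of functions on \<open>U\<close>
  (of functions restricted to \<open>U\<close>, with repeated members counting as dependent).
\<close>

definition lin_indep_on :: "'a set \<Rightarrow> 'i set \<Rightarrow> ('i \<Rightarrow> 'a \<Rightarrow> complex) \<Rightarrow> bool" where
  "lin_indep_on U J F \<longleftrightarrow> (\<forall>S c. finite S \<and> S \<subseteq> J \<and> (\<forall>x\<in>U. (\<Sum>i\<in>S. c i * F i x) = 0)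
     \<longrightarrow> (\<forall>i\<in>S. c i = 0))"

end

theory Submission
  imports
    Defs
    "HOL-Complex_Analysis.Cauchy_Integral_Formula"
    "HOL-Computational_Algebra.Field_as_Ring"
    "Subresultants.Subresultant_Gcd"
begin

text \<open>
  Writing \<open>\<tau>(n, a)\<close> for \<open>\<tau>\<^sub>\<rho>\<close> with exponent \<open>(n, a)\<close> and \<open>\<Phi>(n, i)\<close> for the hypergeometric
  polynomials, one has \<open>\<Sum>\<^sub>i \<Phi>(n, i) t\<^sup>i = f(x;t)\<^sup>n / n!\<close>, hence \<open>\<tau>(n, a)\<close> is the integral of
  \<open>f(x;t)\<^sup>n / n! \<cdot> t powi (- a - 1)\<close> from the distinguished root to \<open>\<rho>\<close>.  Differentiation in \<open>x\<^sub>j\<close>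
  multiplies the integrand by \<open>n t^k\<^sub>j / f\<close> and contributes boundary values, which also carry the
  factor \<open>t^k\<^sub>j\<close> because \<open>\<partial>\<rho>/\<partial>x\<^sub>j = - \<rho>^k\<^sub>j / f'(\<rho>)\<close>.  So for all \<open>n\<close>
    \<open>\<partial>\<^sub>j \<tau>(n, a) = \<partial>\<^sub>0 \<tau>(n, a - k\<^sub>j)\<close>,
  and \<open>\<Phi>\<close> satisfies the same rule.  Partial derivatives of holomorphic functions commute, so a
  product of \<open>\<partial>\<^sub>j\<close> applied to such a family depends only on the number of factors and on the sum of
  their \<open>k\<^sub>j\<close>; this is the content of the toric equations (\<open>shift_family_toric\<close>).  The two Euler
  equations follow from those for \<open>\<Phi>\<close> together with \<open>\<Sum>\<^sub>j x\<^sub>j \<partial>\<^sub>j\<rho> = 0\<close> and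
  \<open>\<Sum>\<^sub>j k\<^sub>j x\<^sub>j \<partial>\<^sub>j\<rho> = - \<rho>\<close> (\<open>tau_weighted_Euler\<close>).

  For linear independence, a relation at \<open>\<alpha> = \<A>u\<close> is differentiated by \<open>\<Prod>\<^sub>j \<partial>\<^sub>j^u\<^sub>j\<close>; this lowers
  the exponent to \<open>(0, 0)\<close> because the boundary values vanish as long as \<open>n > 0\<close>.  Differentiating
  further and using the shift rule shows that, for every \<open>s\<close> that is a sum of exponents \<open>k\<^sub>j\<close>, some
  power of \<open>\<partial>\<^sub>0\<close> kills \<open>\<Sum>\<^sub>\<rho> c\<^sub>\<rho> \<rho>^s\<close>, where \<open>\<rho>\<close> now runs over all roots in the relation and the
  distinguished one, whose coefficient is chosen so that the \<open>c\<^sub>\<rho>\<close> add up to \<open>0\<close>.  As the exponents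
  have greatest common divisor 1, this covers all large \<open>s\<close>: these weighted power sums are
  polynomials in \<open>z = x\<^sub>0\<close>.  Interpolation with the kernel \<open>(f(t) - f(\<rho>)) / (t - \<rho>)\<close> then yields one
  polynomial \<open>W\<close>, independent of the root, with \<open>W(t) = c\<^sub>\<rho> t\<^sup>C f'(t)\<close> at every value \<open>t\<close> taken by
  \<open>\<rho>\<close> when \<open>z\<close> varies.  There are infinitely many such values, so this is a polynomial identity and all \<open>c\<^sub>\<rho>\<close> are
  equal (\<open>coefficients_equal\<close>); having sum \<open>0\<close>, they vanish.
\<close>

no_notation fps_nth (infixl "$" 75)
no_notation Matrix.vec_index (infixl "$" 100)
hide_const (open) Matrix.vec Matrix.mat Matrix.row Determinant.det

section \<open>Commuting partial derivatives of holomorphic functions\<close>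

text \<open>
  Partial derivatives are taken along the line \<open>\<zeta> \<mapsto> x + axis j \<zeta>\<close>: unlike the coordinate updates
  in \<open>pd\<close>, such lines can be translated and two of them can be interchanged by plain vector
  arithmetic.
\<close>

definition has_pd :: "'n::finite \<Rightarrow> (complex ^ 'n \<Rightarrow> complex) \<Rightarrow> complex \<Rightarrow> complex ^ 'n \<Rightarrow> bool" where
  "has_pd j \<phi> D x \<longleftrightarrow> ((\<lambda>\<zeta>. \<phi> (x + axis j \<zeta>)) has_field_derivative D) (at 0)"

lemma update_eq_plus_axis:
  "(\<chi> i. if i = j then z else x $ i) = x + axis j (z - x $ j)" for x :: "complex ^ 'n::finite"
  by (auto simp: vec_eq_iff axis_def)

lemma has_field_derivative_line_iff:
  "((\<lambda>\<zeta>. \<phi> (x + axis j \<zeta>)) has_field_derivative D) (at \<zeta>0) \<longleftrightarrow> has_pd j \<phi> D (x + axis j \<zeta>0)"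
  for x :: "complex ^ 'n::finite"
proof -
  have "axis j (z + w) = axis j z + (axis j w :: complex ^ 'n)" for z w
    by (auto simp: vec_eq_iff axis_def)
  then have eq: "(\<lambda>\<zeta>. \<phi> (x + axis j (\<zeta> + \<zeta>0))) = (\<lambda>\<zeta>. \<phi> (x + axis j \<zeta>0 + axis j \<zeta>))"
    by (auto simp: algebra_simps)
  show ?thesis
    using DERIV_shift[of "\<lambda>\<zeta>. \<phi> (x + axis j \<zeta>)" D 0 \<zeta>0]
    unfolding has_pd_def eq[symmetric] by simp
qed

lemma has_pd_iff_update:
  "has_pd j \<phi> D x \<longleftrightarrow> ((\<lambda>z. \<phi> (\<chi> i. if i = j then z else x $ i)) has_field_derivative D) (at (x $ j))"
  using DERIV_shift[of "\<lambda>z. \<phi> (\<chi> i. if i = j then z else x $ i)" D 0 "x $ j"]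
  unfolding update_eq_plus_axis has_pd_def by simp

lemma has_pd_imp_pd: "has_pd j \<phi> D x \<Longrightarrow> pd j \<phi> x = D"
  unfolding has_pd_iff_update pd_def by (rule DERIV_imp_deriv)

lemma pd_eq_deriv_line: "pd j \<phi> x = deriv (\<lambda>\<zeta>. \<phi> (x + axis j \<zeta>)) 0"
  unfolding pd_def deriv_def has_pd_iff_update[symmetric] unfolding has_pd_def ..

lemma has_pd_unique: "has_pd j \<phi> D x \<Longrightarrow> has_pd j \<phi> D' x \<Longrightarrow> D = D'"
  using has_pd_imp_pd by metis

lemma axis_0 [simp]: "axis j 0 = (0 :: complex ^ 'n::finite)"
  by (simp add: vec_eq_iff axis_def)

lemma norm_axis: "norm (axis j z :: complex ^ 'n::finite) = norm z"
proof -
  have "(\<Sum>i\<in>UNIV. (norm ((axis j z :: complex ^ 'n) $ i))\<^sup>2) = (\<Sum>i\<in>UNIV. if i = j then (norm z)\<^sup>2 else 0)"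
    by (intro sum.cong) (auto simp: axis_def)
  then show ?thesis by (simp add: norm_vec_def L2_set_def)
qed

lemma bounded_linear_axis: "bounded_linear (axis j :: complex \<Rightarrow> complex ^ 'n::finite)"
proof (rule bounded_linear_intro[where K = 1])
  show "norm (axis j z :: complex ^ 'n) \<le> norm z * 1" for z :: complex
    by (simp add: norm_axis)
qed (auto simp: vec_eq_iff axis_def)

lemma continuous_on_axis [continuous_intros]:
  "continuous_on S g \<Longrightarrow> continuous_on S (\<lambda>z. axis j (g z) :: complex ^ 'n::finite)"
  by (rule bounded_linear.continuous_on[OF bounded_linear_axis])

lemma has_pd_cong:
  assumes "open U" "x \<in> U" "\<And>y. y \<in> U \<Longrightarrow> \<phi> y = \<psi> y"
  shows "has_pd j \<phi> D x \<longleftrightarrow> has_pd j \<psi> D x"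
proof -
  have "open ((\<lambda>\<zeta>. x + axis j \<zeta>) -` U)"
    by (rule open_vimage[OF assms(1)]) (intro continuous_intros)
  moreover have "0 \<in> (\<lambda>\<zeta>. x + axis j \<zeta>) -` U"
    using assms(2) by simp
  ultimately have "eventually (\<lambda>\<zeta>. \<phi> (x + axis j \<zeta>) = \<psi> (x + axis j \<zeta>)) (nhds 0)"
    by (auto simp: eventually_nhds intro!: exI[of _ "(\<lambda>\<zeta>. x + axis j \<zeta>) -` U"] assms(3))
  then show ?thesis
    unfolding has_pd_def by (intro DERIV_cong_ev) auto
qed

lemma pd_cong:
  assumes "open U" "x \<in> U" "\<And>y. y \<in> U \<Longrightarrow> \<phi> y = \<psi> y"
  shows "pd j \<phi> x = pd j \<psi> x"
  unfolding pd_eq_deriv_line deriv_def has_pd_def[symmetric]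
  using has_pd_cong[OF assms] by simp

lemma funpow_pd_cong:
  assumes "open U" "\<And>y. y \<in> U \<Longrightarrow> \<phi> y = \<psi> y" "x \<in> U"
  shows "(pd j ^^ r) \<phi> x = (pd j ^^ r) \<psi> x"
  using assms(3)
proof (induction r arbitrary: x)
  case (Suc r)
  then show ?case using pd_cong[OF assms(1) Suc.prems, of "(pd j ^^ r) \<phi>" "(pd j ^^ r) \<psi>"] by simp
qed (use assms(2) in auto)

text \<open>
  The class of functions in which derivatives are iterated.  Continuity plus separate
  holomorphy follows from \<open>holo_on\<close> and passes to partial derivatives by one-variable arguments
  alone.
\<close>

definition sep_holo_on :: "(complex ^ 'n::finite \<Rightarrow> complex) \<Rightarrow> (complex ^ 'n) set \<Rightarrow> bool" where
  "sep_holo_on \<phi> U \<longleftrightarrow> continuous_on U \<phi> \<and> (\<forall>x\<in>U. \<forall>j. has_pd j \<phi> (pd j \<phi> x) x)"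

lemma holo_on_imp_has_pd:
  assumes "holo_on \<phi> U" "open U" "x \<in> U"
  shows "has_pd j \<phi> (pd j \<phi> x) x"
proof -
  obtain D where D: "(\<phi> has_derivative D) (at x within U)" "\<And>c v. D (c *s v) = c * D v"
    using assms unfolding holo_on_def by blast
  from D(1) have D': "(\<phi> has_derivative D) (at x)"
    by (simp only: at_within_open[OF assms(3,2)])
  have "((\<lambda>\<zeta>. x + axis j \<zeta>) has_derivative axis j) (at 0)"
    using has_derivative_add[OF has_derivative_const
        bounded_linear_imp_has_derivative[OF bounded_linear_axis]] by simp
  then have "((\<lambda>\<zeta>. \<phi> (x + axis j \<zeta>)) has_derivative (\<lambda>\<zeta>. D (axis j \<zeta>))) (at 0)"
    by (rule has_derivative_compose) (use D' in simp)
  moreover have "\<zeta> * D (axis j 1) = D (axis j \<zeta>)" for \<zeta>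
  proof -
    have "\<zeta> *s (axis j 1 :: complex ^ 'a) = axis j \<zeta>"
      by (auto simp: vec_eq_iff axis_def)
    then show ?thesis by (simp only: D(2)[symmetric])
  qed
  ultimately have "has_pd j \<phi> (D (axis j 1)) x"
    unfolding has_pd_def by (rule has_derivative_imp_has_field_derivative)
  then show ?thesis by (simp only: has_pd_imp_pd)
qed

lemma holo_on_imp_sep_holo_on:
  assumes "holo_on \<phi> U" "open U"
  shows "sep_holo_on \<phi> U"
  unfolding sep_holo_on_def
proof (intro conjI ballI allI)
  show "continuous_on U \<phi>"
    using assms(1) unfolding holo_on_def continuous_on_eq_continuous_within
    by (meson has_derivative_continuous)
qed (use holo_on_imp_has_pd assms in blast)

lemma sep_holo_on_line:
  assumes "sep_holo_on \<phi> U" "\<And>\<zeta>. \<zeta> \<in> S \<Longrightarrow> x + axis j \<zeta> \<in> U"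
  shows "(\<lambda>\<zeta>. \<phi> (x + axis j \<zeta>)) holomorphic_on S"
proof -
  have "((\<lambda>\<zeta>. \<phi> (x + axis j \<zeta>)) has_field_derivative pd j \<phi> (x + axis j \<zeta>)) (at \<zeta>)"
    if "\<zeta> \<in> S" for \<zeta>
    using assms that unfolding has_field_derivative_line_iff sep_holo_on_def by blast
  then show ?thesis
    by (meson field_differentiable_at_within field_differentiable_def holomorphic_onI)
qed

text \<open>
  By Cauchy's inequality on a circle of fixed radius, \<open>\<partial>\<^sub>j\<phi>(y) - \<partial>\<^sub>j\<phi>(x)\<close> is controlled by the
  oscillation of \<open>\<phi>\<close>, which is small by uniform continuity on a compact ball.
\<close>

lemma continuous_on_pd:
  assumes \<phi>: "sep_holo_on \<phi> U" and "open U"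
  shows "continuous_on U (pd j \<phi>)"
  unfolding continuous_on_iff
proof (intro ballI allI impI)
  fix x e assume x: "x \<in> U" and e: "0 < (e::real)"
  obtain r where r: "r > 0" "cball x (2 * r) \<subseteq> U"
  proof -
    obtain e where "e > 0" "cball x e \<subseteq> U" using assms(2) x open_contains_cball by blast
    then show ?thesis using that[of "e/2"] by auto
  qed
  have "uniformly_continuous_on (cball x (2 * r)) \<phi>"
    using \<phi> r(2) continuous_on_subset unfolding sep_holo_on_def
    by (intro compact_uniformly_continuous) auto
  then obtain \<delta> where \<delta>: "\<delta> > 0"
    "\<And>y z. y \<in> cball x (2 * r) \<Longrightarrow> z \<in> cball x (2 * r) \<Longrightarrow> dist z y < \<delta> \<Longrightarrow> dist (\<phi> z) (\<phi> y) < e * r / 2"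
    by (rule uniformly_continuous_onE[of _ _ "e * r / 2"]) (use e r(1) in auto)
  have "dist (pd j \<phi> y) (pd j \<phi> x) < e" if y: "y \<in> U" "dist y x < min r \<delta>" for y
  proof -
    have mem: "y + axis j \<zeta> \<in> cball x (2 * r)" "x + axis j \<zeta> \<in> cball x (2 * r)"
      if "norm \<zeta> \<le> r" for \<zeta>
    proof -
      have "dist (y + axis j \<zeta>) x \<le> dist (y + axis j \<zeta>) y + dist y x"
        by (rule dist_triangle)
      also have "dist (y + axis j \<zeta>) y = norm \<zeta>"
        by (simp add: dist_norm norm_axis)
      finally have "dist (y + axis j \<zeta>) x \<le> 2 * r"
        using y that by simp
      then show "y + axis j \<zeta> \<in> cball x (2 * r)"
        by (simp add: dist_commute)
      show "x + axis j \<zeta> \<in> cball x (2 * r)"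
        using r(1) that by (simp add: dist_norm norm_axis)
    qed
    define h where "h \<zeta> = \<phi> (y + axis j \<zeta>) - \<phi> (x + axis j \<zeta>)" for \<zeta>
    have hol: "h holomorphic_on cball 0 r"
      unfolding h_def using mem r(2)
      by (intro holomorphic_intros sep_holo_on_line[OF \<phi>]) auto
    have "norm ((deriv ^^ 1) h 0) \<le> fact 1 * (e * r / 2) / r ^ 1"
    proof (rule Cauchy_inequality)
      show "h holomorphic_on ball 0 r" "continuous_on (cball 0 r) h"
        using hol holomorphic_on_imp_continuous_on holomorphic_on_subset ball_subset_cball by blast+
      fix \<zeta> :: complex assume "norm (0 - \<zeta>) = r"
      then show "norm (h \<zeta>) \<le> e * r / 2"
        using mem[of \<zeta>] \<delta>(2)[OF mem(2,1), of \<zeta> \<zeta>] y unfolding h_def by (auto simp: dist_norm)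
    qed (use r in auto)
    moreover have "(h has_field_derivative (pd j \<phi> y - pd j \<phi> x)) (at 0)"
      unfolding h_def using \<phi> x y unfolding sep_holo_on_def has_pd_def
      by (intro derivative_intros) auto
    ultimately have "norm (pd j \<phi> y - pd j \<phi> x) \<le> e / 2"
      using r(1) DERIV_imp_deriv by fastforce
    then show ?thesis using e by (simp add: dist_norm)
  qed
  then show "\<exists>d>0. \<forall>x'\<in>U. dist x' x < d \<longrightarrow> dist (pd j \<phi> x') (pd j \<phi> x) < e"
    using r \<delta> by (intro exI[of _ "min r \<delta>"]) auto
qed

text \<open>
  The difference quotients \<open>q\<^sub>h\<close> of \<open>\<phi>\<close> in direction \<open>j\<close> are holomorphic in direction \<open>i\<close> and
  converge uniformly to \<open>\<partial>\<^sub>j\<phi>\<close>, by continuity of \<open>\<partial>\<^sub>j\<phi>\<close>.  Weierstrass' theorem gives convergence of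
  their derivatives; but these are the difference quotients of \<open>\<partial>\<^sub>i\<phi>\<close> in direction \<open>j\<close>, so the same
  limit is both mixed derivatives.
\<close>

lemma has_pd_pd_commute:
  assumes \<phi>: "sep_holo_on \<phi> U" and "open U" and x: "x \<in> U"
  shows "\<exists>D. has_pd i (pd j \<phi>) D x \<and> has_pd j (pd i \<phi>) D x"
proof -
  obtain r where r: "r > 0" "cball x (2 * r) \<subseteq> U"
  proof -
    obtain e where "e > 0" "cball x e \<subseteq> U" using assms(2) x open_contains_cball by blast
    then show ?thesis using that[of "e/2"] by auto
  qed
  have mem: "x + axis i z + axis j w \<in> cball x (2 * r)" if "norm z \<le> r" "norm w \<le> r" for z w
  proof -
    have "norm (axis i z + axis j w :: complex ^ 'a) \<le> norm z + norm w"
      using norm_triangle_ineq[of "axis i z :: complex ^ 'a" "axis j w"] by (simp add: norm_axis)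
    moreover have "x + axis i z + axis j w - x = axis i z + axis j w" by simp
    ultimately have "dist (x + axis i z + axis j w) x \<le> 2 * r"
      using that unfolding dist_norm by auto
    then show ?thesis
      by (simp add: dist_commute)
  qed
  have line: "((\<lambda>w. \<phi> (y + axis l w)) has_field_derivative pd l \<phi> (y + axis l w)) (at w)"
    if "y + axis l w \<in> U" for y l w
    using \<phi> that unfolding has_field_derivative_line_iff sep_holo_on_def by blast
  \<comment> \<open>\<open>q\<close> is the difference quotient in direction \<open>j\<close>, and \<open>q'\<close> its derivative in direction \<open>i\<close>.\<close>
  define q where "q h z = (\<phi> (x + axis i z + axis j h) - \<phi> (x + axis i z)) / h" for h z
  define q' where "q' h z = (pd i \<phi> (x + axis i z + axis j h) - pd i \<phi> (x + axis i z)) / h" for h z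
  have ul: "uniform_limit (cball 0 r) q (\<lambda>z. pd j \<phi> (x + axis i z)) (at 0)"
  proof (rule uniform_limitI)
    fix e :: real assume e: "e > 0"
    have "uniformly_continuous_on (cball x (2 * r)) (pd j \<phi>)"
      by (intro compact_uniformly_continuous continuous_on_subset[OF continuous_on_pd[OF \<phi> assms(2)] r(2)]) auto
    then obtain \<delta> where \<delta>: "\<delta> > 0"
      "\<And>y z. y \<in> cball x (2 * r) \<Longrightarrow> z \<in> cball x (2 * r) \<Longrightarrow> dist z y < \<delta> \<Longrightarrow> dist (pd j \<phi> z) (pd j \<phi> y) < e / 2"
      by (rule uniformly_continuous_onE[of _ _ "e / 2"]) (use e in auto)
    have "dist (q h z) (pd j \<phi> (x + axis i z)) < e"
      if h: "h \<noteq> 0" "norm h < min r \<delta>" and z: "z \<in> cball 0 r" for h z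
    proof -
      define y where "y = x + axis i z"
      have y: "y + axis j w \<in> cball x (2 * r)" if "norm w \<le> norm h" for w
        unfolding y_def using z h that by (intro mem) auto
      from y[of 0] have y0: "y \<in> cball x (2 * r)" by simp
      \<comment> \<open>Subtracting the linear part turns the estimate into the mean value inequality.\<close>
      let ?g = "\<lambda>w. \<phi> (y + axis j w) - pd j \<phi> y * w"
      have "norm (?g h - ?g 0) \<le> (e / 2) * norm (h - 0)"
      proof (rule field_differentiable_bound[where S = "cball 0 (norm h)"])
        fix w :: complex assume "w \<in> cball 0 (norm h)"
        then have w: "norm w \<le> norm h" by simp
        show "(?g has_field_derivative pd j \<phi> (y + axis j w) - pd j \<phi> y) (at w within cball 0 (norm h))"
          using y[OF w] r(2)
          by (auto intro!: derivative_eq_intros has_field_derivative_at_within[OF line])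
        show "norm (pd j \<phi> (y + axis j w) - pd j \<phi> y) \<le> e / 2"
          using \<delta>(2)[OF y0 y[OF w]] w h by (auto simp: dist_norm norm_axis)
      qed auto
      moreover have "q h z - pd j \<phi> y = (?g h - ?g 0) / h"
        unfolding q_def y_def[symmetric] using h by (simp add: field_simps)
      ultimately have "norm (q h z - pd j \<phi> y) \<le> e / 2"
        using h by (simp add: norm_divide divide_le_eq)
      then show ?thesis using e by (simp add: dist_norm y_def)
    qed
    then show "\<forall>\<^sub>F h in at 0. \<forall>z\<in>cball 0 r. dist (q h z) (pd j \<phi> (x + axis i z)) < e"
      using r(1) \<delta>(1) by (auto simp: eventually_at intro!: exI[of _ "min r \<delta>"])
  qed
  have inner: "(q h has_field_derivative q' h z) (at z)" if "h \<noteq> 0" "norm h < r" "norm z \<le> r" for h z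
  proof -
    have swap: "x + axis i z + axis j h = x + axis j h + axis i z" for z by simp
    have "x + axis j h + axis i z \<in> U" "x + axis i z + axis j 0 \<in> U"
      using mem[of z h] mem[of z 0] r that by (auto simp flip: swap)
    then show ?thesis
      unfolding q_def q'_def swap using that
      by (auto intro!: derivative_eq_intros line)
  qed
  have "\<forall>\<^sub>F h in at 0. continuous_on (cball 0 r) (q h) \<and>
      (\<forall>w\<in>ball 0 r. (q h has_field_derivative q' h w) (at w))"
  proof -
    have "\<forall>\<^sub>F h in at (0::complex). h \<noteq> 0 \<and> norm h < r"
      using r(1) by (auto simp: eventually_at)
    then show ?thesis
    proof eventually_elim
      case (elim h)
      then have "\<And>z. z \<in> cball 0 r \<Longrightarrow> (q h has_field_derivative q' h z) (at z)"
        using inner by auto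
      then show ?case
        by (auto intro!: continuous_at_imp_continuous_on DERIV_isCont)
    qed
  qed
  then obtain g' where g': "\<And>w. w \<in> ball 0 r \<Longrightarrow>
      ((\<lambda>z. pd j \<phi> (x + axis i z)) has_field_derivative g' w) (at w) \<and> ((\<lambda>h. q' h w) \<longlongrightarrow> g' w) (at 0)"
    using ul trivial_limit_at[of "0 :: complex"] r(1)
    by (rule has_complex_derivative_uniform_limit) blast
  have "has_pd i (pd j \<phi>) (g' 0) x" "has_pd j (pd i \<phi>) (g' 0) x"
    using g'[of 0] r(1) unfolding has_pd_def DERIV_def q'_def by (simp_all)
  then show ?thesis by blast
qed

lemma sep_holo_on_pd:
  assumes "sep_holo_on \<phi> U" "open U"
  shows "sep_holo_on (pd j \<phi>) U"
  unfolding sep_holo_on_def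
  using continuous_on_pd[OF assms] has_pd_pd_commute[OF assms] has_pd_imp_pd by metis

lemma pd_commute:
  assumes "sep_holo_on \<phi> U" "open U" "x \<in> U"
  shows "pd i (pd j \<phi>) x = pd j (pd i \<phi>) x"
  using has_pd_pd_commute[OF assms] has_pd_imp_pd by metis

lemma sep_holo_on_funpow_pd:
  "sep_holo_on \<phi> U \<Longrightarrow> open U \<Longrightarrow> sep_holo_on ((pd j ^^ r) \<phi>) U"
  by (induction r) (auto intro: sep_holo_on_pd)

lemma pd_funpow_commute:
  assumes "sep_holo_on \<phi> U" "open U" "x \<in> U"
  shows "pd i ((pd j ^^ r) \<phi>) x = (pd j ^^ r) (pd i \<phi>) x"
  using assms(3)
proof (induction r arbitrary: x)
  case (Suc r)
  have "pd i ((pd j ^^ Suc r) \<phi>) x = pd j (pd i ((pd j ^^ r) \<phi>)) x"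
    using pd_commute[OF sep_holo_on_funpow_pd[OF assms(1,2)] assms(2) Suc.prems] by simp
  also have "\<dots> = pd j ((pd j ^^ r) (pd i \<phi>)) x"
    by (rule pd_cong[OF assms(2) Suc.prems Suc.IH])
  finally show ?case by simp
qed simp

section \<open>Calculus of holomorphic functions of several variables\<close>

lemma has_pd_add: "has_pd j \<phi> a x \<Longrightarrow> has_pd j \<psi> b x \<Longrightarrow> has_pd j (\<lambda>y. \<phi> y + \<psi> y) (a + b) x"
  unfolding has_pd_def by (rule DERIV_add)

lemma has_pd_cmult: "has_pd j \<phi> a x \<Longrightarrow> has_pd j (\<lambda>y. c * \<phi> y) (c * a) x"
  unfolding has_pd_def by (rule DERIV_cmult)

lemma has_pd_mult:
  "has_pd j \<phi> a x \<Longrightarrow> has_pd j \<psi> b x \<Longrightarrow> has_pd j (\<lambda>y. \<phi> y * \<psi> y) (a * \<psi> x + \<phi> x * b) x"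
  unfolding has_pd_def by (auto intro!: derivative_eq_intros)

lemma has_pd_sum:
  "(\<And>i. i \<in> A \<Longrightarrow> has_pd j (\<phi> i) (D i) x) \<Longrightarrow> has_pd j (\<lambda>y. \<Sum>i\<in>A. \<phi> i y) (\<Sum>i\<in>A. D i) x"
  unfolding has_pd_def by (rule DERIV_sum)

lemma has_pd_compose:
  "has_pd j \<phi> a x \<Longrightarrow> (g has_field_derivative b) (at (\<phi> x)) \<Longrightarrow> has_pd j (\<lambda>y. g (\<phi> y)) (b * a) x"
  unfolding has_pd_def using DERIV_chain2[of g b "\<lambda>\<zeta>. \<phi> (x + axis j \<zeta>)" 0 a UNIV] by simp

lemma has_pd_component: "has_pd j (\<lambda>y. y $ i) (if i = j then 1 else 0) x"
  unfolding has_pd_def by (auto simp: axis_def intro!: derivative_eq_intros)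

lemma has_pd_const: "has_pd j (\<lambda>y. c) 0 x"
  unfolding has_pd_def by simp

lemma holo_onE:
  assumes "holo_on \<phi> U" "x \<in> U"
  obtains D where "(\<phi> has_derivative D) (at x within U)" "\<And>c v. D (c *s v) = c * D v"
  using assms unfolding holo_on_def by blast

lemma holo_onI:
  assumes "\<And>x. x \<in> U \<Longrightarrow> (\<phi> has_derivative D x) (at x within U)"
    "\<And>x c v. x \<in> U \<Longrightarrow> D x (c *s v) = c * D x v"
  shows "holo_on \<phi> U"
  using assms unfolding holo_on_def by blast

lemma holo_on_const: "holo_on (\<lambda>x. c) U"
  by (rule holo_onI[where D = "\<lambda>_ _. 0"]) auto

lemma holo_on_component: "holo_on (\<lambda>x. x $ j) U"
  by (rule holo_onI[where D = "\<lambda>_ v. v $ j"])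
    (auto intro!: bounded_linear_imp_has_derivative bounded_linear_vec_nth)

lemma holo_on_add:
  assumes "holo_on \<phi> U" "holo_on \<psi> U"
  shows "holo_on (\<lambda>x. \<phi> x + \<psi> x) U"
  unfolding holo_on_def
proof
  fix x assume x: "x \<in> U"
  obtain D where D: "(\<phi> has_derivative D) (at x within U)" "\<And>c v. D (c *s v) = c * D v"
    by (rule holo_onE[OF assms(1) x]) (rule that)
  obtain E where E: "(\<psi> has_derivative E) (at x within U)" "\<And>c v. E (c *s v) = c * E v"
    by (rule holo_onE[OF assms(2) x]) (rule that)
  show "\<exists>D. ((\<lambda>x. \<phi> x + \<psi> x) has_derivative D) (at x within U) \<and> (\<forall>c v. D (c *s v) = c * D v)"
    by (intro exI[of _ "\<lambda>v. D v + E v"] conjI has_derivative_add D(1) E(1))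
      (simp add: D(2) E(2) distrib_left)
qed

lemma holo_on_mult:
  assumes "holo_on \<phi> U" "holo_on \<psi> U"
  shows "holo_on (\<lambda>x. \<phi> x * \<psi> x) U"
  unfolding holo_on_def
proof
  fix x assume x: "x \<in> U"
  obtain D where D: "(\<phi> has_derivative D) (at x within U)" "\<And>c v. D (c *s v) = c * D v"
    by (rule holo_onE[OF assms(1) x]) (rule that)
  obtain E where E: "(\<psi> has_derivative E) (at x within U)" "\<And>c v. E (c *s v) = c * E v"
    by (rule holo_onE[OF assms(2) x]) (rule that)
  show "\<exists>D. ((\<lambda>x. \<phi> x * \<psi> x) has_derivative D) (at x within U) \<and> (\<forall>c v. D (c *s v) = c * D v)"
    by (intro exI[of _ "\<lambda>v. \<phi> x * E v + D v * \<psi> x"] conjI has_derivative_mult D(1) E(1))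
      (simp add: D(2) E(2) algebra_simps)
qed

lemma holo_on_compose:
  assumes "holo_on \<phi> U" "\<And>x. x \<in> U \<Longrightarrow> (g has_field_derivative g' x) (at (\<phi> x))"
  shows "holo_on (\<lambda>x. g (\<phi> x)) U"
  unfolding holo_on_def
proof
  fix x assume x: "x \<in> U"
  obtain D where D: "(\<phi> has_derivative D) (at x within U)" "\<And>c v. D (c *s v) = c * D v"
    by (rule holo_onE[OF assms(1) x]) (rule that)
  have "((\<lambda>x. g (\<phi> x)) has_derivative (\<lambda>v. g' x * D v)) (at x within U)"
    using has_derivative_compose[OF D(1)] assms(2)[OF x]
    unfolding has_field_derivative_def by blast
  then show "\<exists>D. ((\<lambda>x. g (\<phi> x)) has_derivative D) (at x within U) \<and> (\<forall>c v. D (c *s v) = c * D v)"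
    using D(2) by (intro exI[of _ "\<lambda>v. g' x * D v"]) auto
qed

lemma holo_on_sum: "(\<And>i. i \<in> A \<Longrightarrow> holo_on (\<phi> i) U) \<Longrightarrow> holo_on (\<lambda>x. \<Sum>i\<in>A. \<phi> i x) U"
  by (induction A rule: infinite_finite_induct) (auto intro: holo_on_const holo_on_add)

lemma holo_on_prod: "(\<And>i. i \<in> A \<Longrightarrow> holo_on (\<phi> i) U) \<Longrightarrow> holo_on (\<lambda>x. \<Prod>i\<in>A. \<phi> i x) U"
  by (induction A rule: infinite_finite_induct) (auto intro: holo_on_const holo_on_mult)

lemma holo_on_cmult: "holo_on \<phi> U \<Longrightarrow> holo_on (\<lambda>x. c * \<phi> x) U"
  by (intro holo_on_mult holo_on_const)

section \<open>Hypergeometric polynomials\<close>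

lemma mat_A_vec_eq_iff:
  "mat_A k *v v = \<beta> \<longleftrightarrow> (\<Sum>j\<in>UNIV. v $ j) = \<beta> $ 1 \<and> (\<Sum>j\<in>UNIV. int (k j) * v $ j) = \<beta> $ 2"
  by (simp add: vec_eq_iff forall_2 matrix_vector_mult_def mat_A_def)

text \<open>
  The index set of the sum \<open>\<Phi>(n, a)\<close>, with the matrix equation written out in its two rows.
\<close>

definition sols :: "('n::finite \<Rightarrow> nat) \<Rightarrow> int \<Rightarrow> int \<Rightarrow> (nat ^ 'n) set" where
  "sols k n a = {u. (\<Sum>j\<in>UNIV. int (u $ j)) = n \<and> (\<Sum>j\<in>UNIV. int (k j) * int (u $ j)) = a}"

definition divided_monomial :: "nat ^ 'n \<Rightarrow> complex ^ 'n::finite \<Rightarrow> complex" where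
  "divided_monomial u x = (\<Prod>j\<in>UNIV. x $ j ^ (u $ j) / fact (u $ j))"

lemma Phi_eq_sum_sols:
  "Phi k (vector [n, a]) x = (\<Sum>u\<in>sols k n a. divided_monomial u x)"
  unfolding Phi_def sols_def divided_monomial_def mat_A_vec_eq_iff by simp

lemma finite_sols: "finite (sols k n a)"
proof -
  have bound: "u $ j \<le> nat n" if "u \<in> sols k n a" for u :: "nat ^ 'a" and j
  proof -
    have "int (u $ j) \<le> (\<Sum>j\<in>UNIV. int (u $ j))"
      by (rule member_le_sum) auto
    then show ?thesis using that unfolding sols_def by simp
  qed
  have "u \<in> vec_lambda ` (UNIV \<rightarrow>\<^sub>E {..nat n})" if "u \<in> sols k n a" for u :: "nat ^ 'a"
    using bound[OF that] by (intro image_eqI[of _ _ "vec_nth u"]) auto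
  then have "sols k n a \<subseteq> vec_lambda ` (UNIV \<rightarrow>\<^sub>E {..nat n})"
    by blast
  then show ?thesis
    by (rule finite_subset) (intro finite_imageI finite_PiE; simp)
qed

lemma Phi_eq_0:
  assumes "\<And>j. k j \<le> d" "n < 0 \<or> a < 0 \<or> a > int d * n"
  shows "Phi k (vector [n, a]) x = 0"
proof -
  have "sols k n a = {}"
  proof (rule ccontr)
    assume "sols k n a \<noteq> {}"
    then obtain u where u: "(\<Sum>j\<in>UNIV. int (u $ j)) = n" "(\<Sum>j\<in>UNIV. int (k j) * int (u $ j)) = a"
      unfolding sols_def by blast
    have "a \<le> (\<Sum>j\<in>UNIV. int d * int (u $ j))"
      unfolding u(2)[symmetric] using assms(1) by (intro sum_mono mult_right_mono) auto
    moreover have "0 \<le> n" "0 \<le> a"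
      unfolding u[symmetric] by (auto intro!: sum_nonneg)
    ultimately show False using assms(2) u(1) by (auto simp flip: sum_distrib_left)
  qed
  then show ?thesis unfolding Phi_eq_sum_sols by simp
qed

lemma Phi_0: "Phi k (vector [0, a]) x = (if a = 0 then 1 else 0)"
proof -
  have "(\<Sum>j\<in>UNIV. int (u $ j)) = 0 \<longleftrightarrow> u = 0" for u :: "nat ^ 'a"
    by (subst sum_nonneg_eq_0_iff) (auto simp: vec_eq_iff)
  then have "sols k 0 a = {u. u = 0 \<and> (\<Sum>j\<in>UNIV. int (k j) * int (u $ j)) = a}"
    unfolding sols_def by simp
  also have "\<dots> = (if a = 0 then {0} else {})"
    by auto
  finally have "sols k 0 a = (if a = 0 then {0} else {})" .
  then show ?thesis unfolding Phi_eq_sum_sols by (simp add: divided_monomial_def)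
qed

text \<open>
  The bijection \<open>v \<mapsto> v + e\<^sub>j\<close> behind both \<open>\<partial>\<^sub>j \<Phi>(n, a) = \<Phi>(n - 1, a - k\<^sub>j)\<close> and the Euler
  equations for \<open>\<Phi>\<close>.
\<close>

lemma sum_sols_shift:
  fixes k :: "'n::finite \<Rightarrow> nat"
  shows "(\<Sum>v\<in>sols k (n - 1) (a - int (k j)). g (v + axis j 1)) = (\<Sum>u\<in>{u\<in>sols k n a. u $ j \<noteq> 0}. g u)"
proof (rule sum.reindex_bij_witness[where i = "\<lambda>u. u - axis j 1" and j = "\<lambda>v. v + axis j 1"])
  have split: "(\<Sum>i\<in>UNIV. (w i :: int) * int ((v + axis j 1) $ i)) = (\<Sum>i\<in>UNIV. w i * int (v $ i)) + w j"
    for v :: "nat ^ 'n" and w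
  proof -
    have "(\<Sum>i\<in>UNIV. (w i :: int) * int ((v + axis j 1) $ i))
        = (\<Sum>i\<in>UNIV. w i * int (v $ i) + (if i = j then w i else 0))"
      by (intro sum.cong) (auto simp: axis_def algebra_simps)
    then show ?thesis by (simp add: sum.distrib)
  qed
  note split1 = split[of "\<lambda>_. 1", simplified]
  have mem: "v + axis j 1 \<in> sols k n a \<longleftrightarrow> v \<in> sols k (n - 1) (a - int (k j))" for v :: "nat ^ 'n"
    unfolding sols_def using split1[of v] split[of "\<lambda>i. int (k i)" v] by auto
  have inv: "u - axis j 1 + axis j 1 = u" if "u $ j \<noteq> 0" for u :: "nat ^ 'n"
    using that by (auto simp: vec_eq_iff axis_def)
  show "u - axis j 1 + axis j 1 = u" if "u \<in> {u \<in> sols k n a. u $ j \<noteq> 0}" for u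
    using inv that by auto
  show "u - axis j 1 \<in> sols k (n - 1) (a - int (k j))" if "u \<in> {u \<in> sols k n a. u $ j \<noteq> 0}" for u
    using mem[of "u - axis j 1"] inv[of u] that by auto
  show "v + axis j 1 \<in> {u \<in> sols k n a. u $ j \<noteq> 0}" if "v \<in> sols k (n - 1) (a - int (k j))" for v
    using mem[of v] that by (auto simp: axis_def)
  show "v + axis j 1 - axis j 1 = v" for v :: "nat ^ 'n"
    by (auto simp: vec_eq_iff axis_def)
qed auto

text \<open>
  Isolating the factor of one variable is what makes differentiation and multiplication by
  \<open>x\<^sub>j\<close> one-variable computations.
\<close>

lemma divided_monomial_split:
  "divided_monomial u x = x $ j ^ (u $ j) / fact (u $ j) * (\<Prod>i\<in>UNIV-{j}. x $ i ^ (u $ i) / fact (u $ i))"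
  unfolding divided_monomial_def by (rule prod.remove) auto

lemma divided_monomial_step:
  "x $ j * divided_monomial v x = of_nat ((v + axis j 1) $ j) * divided_monomial (v + axis j 1) x"
proof -
  have "(\<Prod>i\<in>UNIV-{j}. x $ i ^ ((v + axis j 1) $ i) / fact ((v + axis j 1) $ i))
      = (\<Prod>i\<in>UNIV-{j}. x $ i ^ (v $ i) / fact (v $ i))"
    by (intro prod.cong) (auto simp: axis_def)
  then show ?thesis
    unfolding divided_monomial_split[of _ _ j] by (simp add: axis_def field_simps del: of_nat_Suc)
qed

lemma has_pd_divided_monomial:
  "has_pd j (divided_monomial (v + axis j 1)) (divided_monomial v x) x"
  "u $ j = 0 \<Longrightarrow> has_pd j (divided_monomial u) 0 x"
proof -
  define C where "C u = (\<Prod>i\<in>UNIV-{j}. x $ i ^ (u $ i) / fact (u $ i))" for u :: "nat ^ 'a"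
  have eq: "divided_monomial u (x + axis j \<zeta>) = (x $ j + \<zeta>) ^ (u $ j) / fact (u $ j) * C u" for u \<zeta>
  proof -
    have "(\<Prod>i\<in>UNIV-{j}. (x + axis j \<zeta>) $ i ^ (u $ i) / fact (u $ i)) = C u"
      unfolding C_def by (intro prod.cong) (auto simp: axis_def)
    then show ?thesis
      unfolding divided_monomial_split[of _ _ j] by (simp add: axis_def)
  qed
  show "has_pd j (divided_monomial u) 0 x" if "u $ j = 0"
    unfolding has_pd_def eq using that by simp
  have "C (v + axis j 1) = C v"
    unfolding C_def by (intro prod.cong) (auto simp: axis_def)
  moreover have "divided_monomial v x = x $ j ^ (v $ j) / fact (v $ j) * C v"
    using eq[of v 0] by simp
  ultimately show "has_pd j (divided_monomial (v + axis j 1)) (divided_monomial v x) x"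
    unfolding has_pd_def eq
    by (auto intro!: derivative_eq_intros simp: axis_def field_simps simp del: of_nat_Suc power_Suc)
qed

lemma has_pd_Phi:
  "has_pd j (Phi k (vector [n, a])) (Phi k (vector [n - 1, a - int (k j)]) x) x"
proof -
  define D where "D u = (if u $ j = 0 then 0 else divided_monomial (u - axis j 1) x)" for u :: "nat ^ 'a"
  have inv: "u - axis j 1 + axis j 1 = u" if "u $ j \<noteq> 0" for u :: "nat ^ 'a"
    using that by (auto simp: vec_eq_iff axis_def)
  have "has_pd j (divided_monomial u) (D u) x" for u
    unfolding D_def using has_pd_divided_monomial(1)[of j "u - axis j 1" x] inv[of u]
      has_pd_divided_monomial(2)[of u j x] by auto
  then have "has_pd j (\<lambda>y. \<Sum>u\<in>sols k n a. divided_monomial u y) (\<Sum>u\<in>sols k n a. D u) x"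
    by (intro has_pd_sum)
  also have "(\<Sum>u\<in>sols k n a. D u) = (\<Sum>u\<in>{u\<in>sols k n a. u $ j \<noteq> 0}. D u)"
    by (rule sum.mono_neutral_right) (auto simp: finite_sols D_def)
  also have "\<dots> = (\<Sum>v\<in>sols k (n - 1) (a - int (k j)). divided_monomial v x)"
    unfolding sum_sols_shift[symmetric]
    by (intro sum.cong) (auto simp: D_def axis_def vec_eq_iff intro!: arg_cong[of _ _ "\<lambda>v. divided_monomial v x"])
  finally show ?thesis
    unfolding Phi_eq_sum_sols[symmetric] .
qed

lemma component_times_Phi:
  "x $ j * Phi k (vector [n - 1, a - int (k j)]) x
    = (\<Sum>u\<in>sols k n a. of_nat (u $ j) * divided_monomial u x)"
proof -
  have "x $ j * Phi k (vector [n - 1, a - int (k j)]) x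
      = (\<Sum>v\<in>sols k (n - 1) (a - int (k j)). of_nat ((v + axis j 1) $ j) * divided_monomial (v + axis j 1) x)"
    unfolding Phi_eq_sum_sols sum_distrib_left divided_monomial_step ..
  also have "\<dots> = (\<Sum>u\<in>{u\<in>sols k n a. u $ j \<noteq> 0}. of_nat (u $ j) * divided_monomial u x)"
    by (rule sum_sols_shift)
  also have "\<dots> = (\<Sum>u\<in>sols k n a. of_nat (u $ j) * divided_monomial u x)"
    by (rule sum.mono_neutral_left) (auto simp: finite_sols)
  finally show ?thesis .
qed

text \<open>
  Every monomial of \<open>\<Phi>(n, a)\<close> is an eigenvector of \<open>\<Sum>\<^sub>j w\<^sub>j x\<^sub>j \<partial>\<^sub>j\<close> with eigenvalue
  \<open>\<Sum>\<^sub>j w\<^sub>j u\<^sub>j\<close>; the weights of interest are \<open>w\<^sub>j = 1\<close> and \<open>w\<^sub>j = k\<^sub>j\<close>.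
\<close>

lemma Phi_weighted_Euler:
  assumes "\<And>u. u \<in> sols k n a \<Longrightarrow> (\<Sum>j\<in>UNIV. w j * of_nat (u $ j)) = c"
  shows "(\<Sum>j\<in>UNIV. w j * x $ j * Phi k (vector [n - 1, a - int (k j)]) x) = c * Phi k (vector [n, a]) x"
proof -
  have "(\<Sum>j\<in>UNIV. w j * x $ j * Phi k (vector [n - 1, a - int (k j)]) x)
      = (\<Sum>j\<in>UNIV. \<Sum>u\<in>sols k n a. w j * (of_nat (u $ j) * divided_monomial u x))"
    unfolding sum_distrib_left[symmetric] component_times_Phi[symmetric] by (simp add: mult_ac)
  also have "\<dots> = (\<Sum>u\<in>sols k n a. (\<Sum>j\<in>UNIV. w j * of_nat (u $ j)) * divided_monomial u x)"
    by (subst sum.swap) (simp add: sum_distrib_right mult.assoc)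
  also have "\<dots> = c * Phi k (vector [n, a]) x"
    unfolding Phi_eq_sum_sols sum_distrib_left using assms by (intro sum.cong) auto
  finally show ?thesis .
qed

lemma Phi_Euler:
  "(\<Sum>j\<in>UNIV. x $ j * Phi k (vector [n - 1, a - int (k j)]) x) = of_int n * Phi k (vector [n, a]) x"
  "(\<Sum>j\<in>UNIV. of_nat (k j) * x $ j * Phi k (vector [n - 1, a - int (k j)]) x)
    = of_int a * Phi k (vector [n, a]) x"
proof -
  have "(\<Sum>j\<in>UNIV. of_nat (u $ j) :: complex) = of_int n"
    "(\<Sum>j\<in>UNIV. of_nat (k j) * of_nat (u $ j) :: complex) = of_int a" if "u \<in> sols k n a" for u
    using that unfolding sols_def by auto
  then show "(\<Sum>j\<in>UNIV. x $ j * Phi k (vector [n - 1, a - int (k j)]) x) = of_int n * Phi k (vector [n, a]) x"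
    "(\<Sum>j\<in>UNIV. of_nat (k j) * x $ j * Phi k (vector [n - 1, a - int (k j)]) x)
    = of_int a * Phi k (vector [n, a]) x"
    using Phi_weighted_Euler[of k n a "\<lambda>_. 1" "of_int n" x]
      Phi_weighted_Euler[of k n a "\<lambda>j. of_nat (k j)" "of_int a" x] by auto
qed

lemma holo_on_Phi: "holo_on (Phi k (vector [n, a])) U"
proof -
  have "holo_on (\<lambda>x. x $ j ^ m / fact m) U" for j :: 'a and m
    by (rule holo_on_compose[OF holo_on_component]) (auto intro!: derivative_eq_intros)
  then show ?thesis
    unfolding Phi_eq_sum_sols divided_monomial_def
    by (intro holo_on_sum holo_on_prod)
qed

section \<open>Roots and the discriminant\<close>

lemma poly_f_poly: "poly (f_poly k x) t = (\<Sum>j\<in>UNIV. x $ j * t ^ k j)"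
  unfolding f_poly_def by (simp add: poly_sum poly_monom)

lemma poly_pderiv_f_poly: "poly (pderiv (f_poly k x)) t = (\<Sum>j\<in>UNIV. x $ j * (of_nat (k j) * t ^ (k j - 1)))"
  unfolding f_poly_def by (simp add: higher_pderiv_sum[of 1, simplified] poly_sum poly_monom pderiv_monom mult_ac)

text \<open>
  A common root \<open>t\<close> makes \<open>X - t\<close> divide the greatest common divisor.
\<close>

lemma resultant_common_root:
  fixes p q :: "complex poly"
  assumes "poly p t = 0" "poly q t = 0" "p \<noteq> 0"
  shows "resultant p q = 0"
proof -
  have "[:- t, 1:] dvd gcd p q"
    using assms(1,2) by (intro gcd_greatest) (auto simp: poly_eq_0_iff_dvd)
  moreover have "gcd p q \<noteq> 0" using assms(3) by simp
  ultimately have "degree [:- t, 1:] \<le> degree (gcd p q)"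
    by (intro dvd_imp_degree_le)
  then show ?thesis
    unfolding div_exp_Lazard_gcd.resultant_0_gcd by simp
qed

text \<open>
  Used to absorb the shift \<open>a \<mapsto> a - k\<^sub>j\<close> in sums over the powers of \<open>t\<close>.
\<close>

lemma sum_int_interval_shift:
  fixes g :: "int \<Rightarrow> complex"
  shows "(\<Sum>i\<in>{l..h}. g (i - c)) = (\<Sum>i\<in>{l - c..h - c}. g i)"
  by (rule sum.reindex_bij_witness[where i = "\<lambda>i. i + c" and j = "\<lambda>i. i - c"]) auto

locale hypergeometric_domain =
  fixes k :: "'n::{finite,linorder} \<Rightarrow> nat" and d :: nat
    and U :: "(complex ^ 'n::{finite,linorder}) set"
  assumes exponents: "exponents k d"
    and open_U: "open U"
    and U_avoids_Sigma: "U \<subseteq> - Sigma_set k"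
begin

abbreviation j0 :: 'n where "j0 \<equiv> Min UNIV"

lemma k_j0: "k j0 = 0" and k_Max: "k (Max UNIV) = d" and strict_mono_k: "strict_mono k"
  using exponents unfolding exponents_def by auto

lemma k_le: "k j \<le> d"
  using strict_mono_k strict_mono_leD[of k j "Max UNIV"] k_Max by simp

lemma k_eq_0_iff: "k j = 0 \<longleftrightarrow> j = j0"
  using strict_mono_k k_j0 by (metis strict_mono_eq)

lemma avoids_Sigma:
  assumes "x \<in> U"
  shows "x $ j0 \<noteq> 0" "discriminant (f_poly k x) \<noteq> 0"
  using assms U_avoids_Sigma unfolding Sigma_set_def by auto

lemma poly_f_poly_0: "poly (f_poly k x) 0 = x $ j0"
proof -
  have "poly (f_poly k x) 0 = (\<Sum>j\<in>UNIV. if j = j0 then x $ j else 0)"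
    unfolding poly_f_poly by (intro sum.cong) (auto simp: k_eq_0_iff zero_power2 power_0_left)
  then show ?thesis by simp
qed

lemma f_poly_nonzero: "x \<in> U \<Longrightarrow> f_poly k x \<noteq> 0"
  using poly_f_poly_0[of x] avoids_Sigma(1)[of x] by auto

lemma root_nonzero: "x \<in> U \<Longrightarrow> poly (f_poly k x) t = 0 \<Longrightarrow> t \<noteq> 0"
  using poly_f_poly_0[of x] avoids_Sigma(1)[of x] by auto

text \<open>
  A double root is a common root of \<open>f\<close> and \<open>f'\<close>, so the resultant and with it the discriminant
  would vanish.
\<close>

lemma root_simple:
  assumes "x \<in> U" "poly (f_poly k x) t = 0"
  shows "poly (pderiv (f_poly k x)) t \<noteq> 0"
proof
  assume "poly (pderiv (f_poly k x)) t = 0"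
  then have "resultant (f_poly k x) (pderiv (f_poly k x)) = 0"
    using assms f_poly_nonzero by (intro resultant_common_root[of _ t]) auto
  then show False
    using avoids_Sigma(2)[OF assms(1)] unfolding discriminant_def by simp
qed

text \<open>
  This is \<open>\<partial>\<rho>/\<partial>x\<^sub>0\<close>; all other partial derivatives of \<open>\<rho>\<close> are its multiples by \<open>\<rho>^k\<^sub>j\<close>.
\<close>

definition root_derivative :: "(complex ^ 'n::{finite,linorder} \<Rightarrow> complex) \<Rightarrow> complex ^ 'n::{finite,linorder} \<Rightarrow> complex" where
  "root_derivative \<rho> x = - 1 / poly (pderiv (f_poly k x)) (\<rho> x)"

context
  fixes \<rho> assumes \<rho>: "\<rho> \<in> roots_on k U"
begin

lemma root_holo: "holo_on \<rho> U" and root_eq: "x \<in> U \<Longrightarrow> poly (f_poly k x) (\<rho> x) = 0"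
  using \<rho> unfolding roots_on_def by auto

lemma root_value_nonzero: "x \<in> U \<Longrightarrow> \<rho> x \<noteq> 0"
  using root_nonzero root_eq by blast

text \<open>
  Implicit differentiation of \<open>f(x; \<rho>(x)) = 0\<close>.
\<close>

lemma has_pd_root:
  assumes x: "x \<in> U"
  shows "has_pd j \<rho> (\<rho> x ^ k j * root_derivative \<rho> x) x"
proof -
  let ?f' = "poly (pderiv (f_poly k x)) (\<rho> x)"
  define a where "a = pd j \<rho> x"
  have a: "has_pd j \<rho> a x"
    unfolding a_def by (rule holo_on_imp_has_pd[OF root_holo open_U x])
  have "has_pd j (\<lambda>y. \<rho> y ^ m) (of_nat m * \<rho> x ^ (m - 1) * a) x" for m
    by (rule has_pd_compose[OF a]) (auto intro!: derivative_eq_intros)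
  then have "has_pd j (\<lambda>y. \<Sum>i\<in>UNIV. y $ i * \<rho> y ^ k i)
      (\<Sum>i\<in>UNIV. (if i = j then 1 else 0) * \<rho> x ^ k i + x $ i * (of_nat (k i) * \<rho> x ^ (k i - 1) * a)) x"
    by (intro has_pd_sum has_pd_mult has_pd_component)
  also have "(\<Sum>i\<in>UNIV. (if i = j then 1 else 0) * \<rho> x ^ k i + x $ i * (of_nat (k i) * \<rho> x ^ (k i - 1) * a))
      = (\<Sum>i\<in>UNIV. if i = j then \<rho> x ^ k i else 0) + (\<Sum>i\<in>UNIV. x $ i * (of_nat (k i) * \<rho> x ^ (k i - 1))) * a"
    by (simp add: sum.distrib sum_distrib_right mult.assoc if_distrib[of "\<lambda>c. c * _"] cong: if_cong)
  also have "\<dots> = \<rho> x ^ k j + ?f' * a"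
    unfolding poly_pderiv_f_poly by simp
  finally have "has_pd j (\<lambda>y. \<Sum>i\<in>UNIV. y $ i * \<rho> y ^ k i) (\<rho> x ^ k j + ?f' * a) x" .
  moreover have "has_pd j (\<lambda>y. \<Sum>i\<in>UNIV. y $ i * \<rho> y ^ k i) 0 x"
    using has_pd_cong[OF open_U x, of "\<lambda>y. \<Sum>i\<in>UNIV. y $ i * \<rho> y ^ k i" "\<lambda>_. 0"] root_eq
    unfolding poly_f_poly by (simp add: has_pd_const)
  ultimately have "\<rho> x ^ k j + ?f' * a = 0"
    by (rule has_pd_unique)
  then have "a = \<rho> x ^ k j * root_derivative \<rho> x"
    using root_simple[OF x root_eq[OF x]] unfolding root_derivative_def
    by (simp add: field_simps add_eq_0_iff)
  with a show ?thesis by simp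
qed

text \<open>
  The two sums are \<open>- f(\<rho>) / f'(\<rho>)\<close> and \<open>- \<rho> f'(\<rho>) / f'(\<rho>)\<close>.
\<close>

lemma root_Euler:
  assumes x: "x \<in> U"
  shows "(\<Sum>j\<in>UNIV. x $ j * (\<rho> x ^ k j * root_derivative \<rho> x)) = 0"
    "(\<Sum>j\<in>UNIV. of_nat (k j) * x $ j * (\<rho> x ^ k j * root_derivative \<rho> x)) = - \<rho> x"
proof -
  have "(\<Sum>j\<in>UNIV. x $ j * (\<rho> x ^ k j * root_derivative \<rho> x))
      = poly (f_poly k x) (\<rho> x) * root_derivative \<rho> x"
    unfolding poly_f_poly by (simp add: sum_distrib_right mult.assoc)
  then show "(\<Sum>j\<in>UNIV. x $ j * (\<rho> x ^ k j * root_derivative \<rho> x)) = 0"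
    using root_eq[OF x] by simp
  have "of_nat (k j) * x $ j * (\<rho> x ^ k j * root_derivative \<rho> x)
      = \<rho> x * (x $ j * (of_nat (k j) * \<rho> x ^ (k j - 1))) * root_derivative \<rho> x" for j
    by (cases "k j") auto
  then have "(\<Sum>j\<in>UNIV. of_nat (k j) * x $ j * (\<rho> x ^ k j * root_derivative \<rho> x))
      = \<rho> x * poly (pderiv (f_poly k x)) (\<rho> x) * root_derivative \<rho> x"
    unfolding poly_pderiv_f_poly by (simp only: sum_distrib_left sum_distrib_right)
  then show "(\<Sum>j\<in>UNIV. of_nat (k j) * x $ j * (\<rho> x ^ k j * root_derivative \<rho> x)) = - \<rho> x"
    using root_simple[OF x root_eq[OF x]] unfolding root_derivative_def by simp
qed

text \<open>
  The generating function is \<open>f\<^sup>n / n!\<close>, a multiple of \<open>f\<close>: by the Euler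
  equation of \<open>\<Phi>\<close>, \<open>n\<close> times the generating function of level \<open>n\<close> is \<open>f\<close> times that of level
  \<open>n - 1\<close>.
\<close>

lemma Phi_generating_sum_root:
  assumes x: "x \<in> U" and n: "n > 0"
  shows "(\<Sum>i\<in>{0..int d * n}. Phi k (vector [n, i]) x * \<rho> x powi i) = 0"
proof -
  let ?P = "\<lambda>n i. Phi k (vector [n, i]) x"
  have shift: "(\<Sum>i\<in>{0..int d * n}. ?P (n - 1) (i - int (k j)) * \<rho> x powi i)
      = \<rho> x ^ k j * (\<Sum>i\<in>{0..int d * (n - 1)}. ?P (n - 1) i * \<rho> x powi i)" for j
  proof -
    have "(\<Sum>i\<in>{0..int d * n}. ?P (n - 1) (i - int (k j)) * \<rho> x powi i)
        = (\<Sum>i\<in>{0..int d * n}. ?P (n - 1) (i - int (k j)) * \<rho> x powi (i - int (k j) + int (k j)))"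
      by simp
    also have "\<dots> = (\<Sum>i\<in>{0 - int (k j)..int d * n - int (k j)}. ?P (n - 1) i * \<rho> x powi (i + int (k j)))"
      by (rule sum_int_interval_shift[of "\<lambda>i. ?P (n - 1) i * \<rho> x powi (i + int (k j))"])
    also have "\<dots> = (\<Sum>i\<in>{0..int d * (n - 1)}. ?P (n - 1) i * \<rho> x powi (i + int (k j)))"
      using k_le[of j] by (intro sum.mono_neutral_right) (auto simp: algebra_simps Phi_eq_0[OF k_le])
    also have "\<dots> = \<rho> x ^ k j * (\<Sum>i\<in>{0..int d * (n - 1)}. ?P (n - 1) i * \<rho> x powi i)"
      using root_value_nonzero[OF x]
      by (simp add: sum_distrib_left power_int_add mult_ac)
    finally show ?thesis .
  qed
  have "of_int n * (\<Sum>i\<in>{0..int d * n}. ?P n i * \<rho> x powi i)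
      = (\<Sum>i\<in>{0..int d * n}. (\<Sum>j\<in>UNIV. x $ j * ?P (n - 1) (i - int (k j))) * \<rho> x powi i)"
    unfolding Phi_Euler(1) by (simp add: sum_distrib_left mult.assoc)
  also have "\<dots> = (\<Sum>j\<in>UNIV. x $ j * (\<Sum>i\<in>{0..int d * n}. ?P (n - 1) (i - int (k j)) * \<rho> x powi i))"
    by (simp add: sum_distrib_left sum_distrib_right mult.assoc sum.swap[of _ UNIV])
  also have "\<dots> = poly (f_poly k x) (\<rho> x) * (\<Sum>i\<in>{0..int d * (n - 1)}. ?P (n - 1) i * \<rho> x powi i)"
    unfolding shift poly_f_poly by (simp add: sum_distrib_right mult.assoc)
  also have "\<dots> = 0" using root_eq[OF x] by simp
  finally show ?thesis using n by simp
qed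

end

section \<open>The functions tau as integrals between two roots\<close>

text \<open>
  This is the integral of \<open>t powi (m - 1)\<close> from \<open>\<rho>'\<close> to \<open>\<rho>\<close>.  Including the logarithm as the
  case \<open>m = 0\<close> makes \<open>\<tau>\<close> a single sum without an exceptional term.
\<close>

definition power_integral :: "(complex ^ 'n::{finite,linorder} \<Rightarrow> complex) \<Rightarrow> (complex ^ 'n::{finite,linorder} \<Rightarrow> complex)
    \<Rightarrow> (complex ^ 'n::{finite,linorder} \<Rightarrow> complex) \<Rightarrow> int \<Rightarrow> complex ^ 'n::{finite,linorder} \<Rightarrow> complex" where
  "power_integral \<rho>' \<rho> lg m x = (if m = 0 then lg x else (\<rho> x powi m - \<rho>' x powi m) / of_int m)"

lemma tau_eq_sum_power_integral:
  "tau k d (vector [n, a]) \<rho>' \<rho> lg x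
    = (\<Sum>i\<in>{0..int d * n}. Phi k (vector [n, i]) x * power_integral \<rho>' \<rho> lg (i - a) x)"
proof (cases "a \<in> {0..int d * n}")
  case True
  then show ?thesis
    unfolding tau_def by (subst sum.remove[of _ a]) (auto simp: power_integral_def)
next
  case False
  then have "Phi k (vector [n, a]) x = 0"
    by (intro Phi_eq_0[OF k_le]) auto
  then show ?thesis
    using False unfolding tau_def
    by (auto simp: power_integral_def intro!: sum.cong)
qed

text \<open>
  The value at the end point \<open>\<rho>\<close> of the integrand \<open>f\<^sup>n / n! \<cdot> t powi (- a - 1)\<close>, times \<open>\<partial>\<^sub>0 \<rho>\<close>.
\<close>

definition boundary_term :: "(complex ^ 'n::{finite,linorder} \<Rightarrow> complex) \<Rightarrow> int \<Rightarrow> int \<Rightarrow> complex ^ 'n::{finite,linorder} \<Rightarrow> complex" where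
  "boundary_term \<rho> n a x =
    (\<Sum>i\<in>{0..int d * n}. Phi k (vector [n, i]) x * \<rho> x powi (i - a - 1)) * root_derivative \<rho> x"

context
  fixes \<rho>' \<rho> lg
  assumes \<rho>': "\<rho>' \<in> roots_on k U" and \<rho>: "\<rho> \<in> roots_on k U" and lg: "log_branch_on U \<rho>' \<rho> lg"
begin

text \<open>
  Only \<open>exp lg = \<rho> / \<rho>'\<close> is known about the branch, so its derivative is recovered by
  differentiating \<open>\<rho>' \<cdot> exp lg = \<rho>\<close>.
\<close>

lemma has_pd_log:
  assumes x: "x \<in> U"
  shows "has_pd j lg (\<rho> x ^ k j * root_derivative \<rho> x / \<rho> x - \<rho>' x ^ k j * root_derivative \<rho>' x / \<rho>' x) x"
    (is "has_pd j lg (?b / _ - ?b' / _) x")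
proof -
  have exp_lg: "exp (lg y) = \<rho> y / \<rho>' y" if "y \<in> U" for y
    using lg that unfolding log_branch_on_def by blast
  have nz: "\<rho> y \<noteq> 0" "\<rho>' y \<noteq> 0" if "y \<in> U" for y
    using root_value_nonzero \<rho> \<rho>' that by blast+
  define a where "a = pd j lg x"
  have a: "has_pd j lg a x"
    using lg holo_on_imp_has_pd[OF _ open_U x] unfolding a_def log_branch_on_def by blast
  have "has_pd j (\<lambda>y. \<rho>' y * exp (lg y)) (?b' * exp (lg x) + \<rho>' x * (exp (lg x) * a)) x"
    by (intro has_pd_mult has_pd_root[OF \<rho>' x] has_pd_compose[OF a] DERIV_exp)
  moreover have "has_pd j (\<lambda>y. \<rho>' y * exp (lg y)) ?b x"
    using has_pd_cong[OF open_U x, of "\<lambda>y. \<rho>' y * exp (lg y)" \<rho>] has_pd_root[OF \<rho> x] exp_lg nz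
    by simp
  ultimately have "?b' * exp (lg x) + \<rho>' x * (exp (lg x) * a) = ?b"
    by (rule has_pd_unique)
  then have "?b' * \<rho> x / \<rho>' x + \<rho> x * a = ?b"
    using exp_lg[OF x] nz[OF x] by simp
  then have "a = ?b / \<rho> x - ?b' / \<rho>' x"
    using nz[OF x] by (simp add: field_simps)
  with a show ?thesis by simp
qed

lemma has_pd_power_integral:
  assumes x: "x \<in> U"
  shows "has_pd j (power_integral \<rho>' \<rho> lg m)
    (\<rho> x powi (m - 1) * (\<rho> x ^ k j * root_derivative \<rho> x)
      - \<rho>' x powi (m - 1) * (\<rho>' x ^ k j * root_derivative \<rho>' x)) x"
proof (cases "m = 0")
  case True
  then have "power_integral \<rho>' \<rho> lg m = lg"
    by (simp add: power_integral_def fun_eq_iff)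
  then show ?thesis
    using has_pd_log[OF x, of j] True by (simp add: field_simps power_int_minus)
next
  case False
  have powi: "has_pd j (\<lambda>y. 1 / of_int m * \<sigma> y powi m) (\<sigma> x powi (m - 1) * (\<sigma> x ^ k j * root_derivative \<sigma> x)) x"
    if "\<sigma> \<in> roots_on k U" for \<sigma>
  proof -
    have "has_pd j (\<lambda>y. \<sigma> y powi m) (of_int m * \<sigma> x powi (m - 1) * 1 * (\<sigma> x ^ k j * root_derivative \<sigma> x)) x"
      using root_value_nonzero[OF that x]
      by (intro has_pd_compose[OF has_pd_root[OF that x]] DERIV_power_int DERIV_ident) auto
    from has_pd_cmult[OF this, of "1 / of_int m"] False show ?thesis by simp
  qed
  have eq: "power_integral \<rho>' \<rho> lg m
      = (\<lambda>y. 1 / of_int m * \<rho> y powi m + (- 1) * (1 / of_int m * \<rho>' y powi m))"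
    using False by (simp add: power_integral_def fun_eq_iff field_simps)
  show ?thesis
    using has_pd_add[OF powi[OF \<rho>] has_pd_cmult[OF powi[OF \<rho>'], of "- 1"]] unfolding eq by simp
qed

lemma holo_on_power_integral: "holo_on (power_integral \<rho>' \<rho> lg m) U"
proof (cases "m = 0")
  case True
  then have "power_integral \<rho>' \<rho> lg m = lg"
    by (simp add: power_integral_def fun_eq_iff)
  then show ?thesis using lg unfolding log_branch_on_def by simp
next
  case False
  have powi: "holo_on (\<lambda>y. \<sigma> y powi m) U" if "\<sigma> \<in> roots_on k U" for \<sigma>
  proof (rule holo_on_compose[OF root_holo[OF that]])
    show "((\<lambda>t. t powi m) has_field_derivative of_int m * \<sigma> y powi (m - 1) * 1) (at (\<sigma> y))"
      if "y \<in> U" for y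
      using root_value_nonzero[OF \<open>\<sigma> \<in> roots_on k U\<close> that] by (intro DERIV_power_int DERIV_ident) auto
  qed
  have eq: "power_integral \<rho>' \<rho> lg m
      = (\<lambda>y. 1 / of_int m * \<rho> y powi m + (- 1 / of_int m) * \<rho>' y powi m)"
    using False by (simp add: power_integral_def fun_eq_iff field_simps)
  show ?thesis
    unfolding eq by (intro holo_on_add holo_on_cmult powi \<rho> \<rho>')
qed

lemma holo_on_tau: "holo_on (tau k d (vector [n, a]) \<rho>' \<rho> lg) U"
  unfolding tau_eq_sum_power_integral
  by (intro holo_on_sum holo_on_mult holo_on_Phi holo_on_power_integral)

lemma has_pd_tau_raw:
  assumes x: "x \<in> U"
  shows "has_pd j (tau k d (vector [n, a]) \<rho>' \<rho> lg)
    (\<Sum>i\<in>{0..int d * n}. Phi k (vector [n - 1, i - int (k j)]) x * power_integral \<rho>' \<rho> lg (i - a) x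
      + Phi k (vector [n, i]) x
        * (\<rho> x powi (i - a - 1) * (\<rho> x ^ k j * root_derivative \<rho> x)
          - \<rho>' x powi (i - a - 1) * (\<rho>' x ^ k j * root_derivative \<rho>' x))) x"
  unfolding tau_eq_sum_power_integral
  by (intro has_pd_sum has_pd_mult has_pd_Phi has_pd_power_integral[OF x])

text \<open>
  Differentiation under the integral sign.  Both summands depend on \<open>j\<close> and \<open>a\<close> only through
  \<open>a - k\<^sub>j\<close>, which is all that the toric equations require, including at level \<open>n = 0\<close>, where the
  boundary terms survive.
\<close>

lemma has_pd_tau:
  assumes x: "x \<in> U"
  shows "has_pd j (tau k d (vector [n, a]) \<rho>' \<rho> lg)
    (tau k d (vector [n - 1, a - int (k j)]) \<rho>' \<rho> lg x
      + (boundary_term \<rho> n (a - int (k j)) x - boundary_term \<rho>' n (a - int (k j)) x)) x"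
proof -
  let ?P = "\<lambda>n i. Phi k (vector [n, i]) x" and ?L = "\<lambda>m. power_integral \<rho>' \<rho> lg m x"
  have "(\<Sum>i\<in>{0..int d * n}. ?P (n - 1) (i - int (k j)) * ?L (i - a))
      = (\<Sum>i\<in>{0..int d * n}. ?P (n - 1) (i - int (k j)) * ?L (i - int (k j) - (a - int (k j))))"
    by simp
  also have "\<dots> = (\<Sum>i\<in>{0 - int (k j)..int d * n - int (k j)}. ?P (n - 1) i * ?L (i - (a - int (k j))))"
    by (rule sum_int_interval_shift[of "\<lambda>i. ?P (n - 1) i * ?L (i - (a - int (k j)))"])
  also have "\<dots> = tau k d (vector [n - 1, a - int (k j)]) \<rho>' \<rho> lg x"
    unfolding tau_eq_sum_power_integral
    using k_le[of j] by (intro sum.mono_neutral_right) (auto simp: algebra_simps Phi_eq_0[OF k_le])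
  finally have tau: "(\<Sum>i\<in>{0..int d * n}. ?P (n - 1) (i - int (k j)) * ?L (i - a))
      = tau k d (vector [n - 1, a - int (k j)]) \<rho>' \<rho> lg x" .
  have bd: "(\<Sum>i\<in>{0..int d * n}. ?P n i * (\<sigma> x powi (i - a - 1) * (\<sigma> x ^ k j * root_derivative \<sigma> x)))
      = boundary_term \<sigma> n (a - int (k j)) x" if "\<sigma> \<in> roots_on k U" for \<sigma>
  proof -
    have "\<sigma> x powi (i - a - 1) * \<sigma> x ^ k j = \<sigma> x powi (i - (a - int (k j)) - 1)" for i
    proof -
      have "\<sigma> x powi (i - (a - int (k j)) - 1) = \<sigma> x powi ((i - a - 1) + int (k j))"
        by (simp add: algebra_simps)
      then show ?thesis using root_value_nonzero[OF that x] by (simp add: power_int_add)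
    qed
    then show ?thesis
      unfolding boundary_term_def sum_distrib_right by (simp add: mult.assoc[symmetric])
  qed
  show ?thesis
    using has_pd_tau_raw[OF x, of j n a]
    unfolding sum.distrib right_diff_distrib sum_subtractf tau bd[OF \<rho>] bd[OF \<rho>'] .
qed

text \<open>
  The integrand contains the factor \<open>f\<^sup>n\<close>, which vanishes at the end points.
\<close>

lemma boundary_term_eq_0:
  assumes "\<sigma> \<in> roots_on k U" "x \<in> U" "n > 0"
  shows "boundary_term \<sigma> n a x = 0"
proof -
  have "\<sigma> x powi (i - a - 1) = \<sigma> x powi i * \<sigma> x powi (- a - 1)" for i
    using root_value_nonzero[OF assms(1,2)] by (simp flip: power_int_add add: algebra_simps)
  then have "boundary_term \<sigma> n a x
      = (\<Sum>i\<in>{0..int d * n}. Phi k (vector [n, i]) x * \<sigma> x powi i) * \<sigma> x powi (- a - 1) * root_derivative \<sigma> x"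
    unfolding boundary_term_def by (simp add: sum_distrib_right mult.assoc)
  then show ?thesis using Phi_generating_sum_root[OF assms] by simp
qed

text \<open>
  Here \<open>c i\<close> is the eigenvalue of \<open>\<Phi>(n, i)\<close> under \<open>\<Sum>\<^sub>j w\<^sub>j x\<^sub>j \<partial>\<^sub>j\<close>, and \<open>e\<close> that of the roots, so
  the power \<open>t powi (i - a)\<close> contributes \<open>e (i - a)\<close>.  The assumption \<open>ce\<close> says that the total
  does not depend on the summand \<open>i\<close>.
\<close>

lemma tau_weighted_Euler:
  assumes x: "x \<in> U"
    and Phi: "\<And>i. (\<Sum>j\<in>UNIV. w j * x $ j * Phi k (vector [n - 1, i - int (k j)]) x) = c i * Phi k (vector [n, i]) x"
    and root: "\<And>\<sigma>. \<sigma> \<in> roots_on k U \<Longrightarrow>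
      (\<Sum>j\<in>UNIV. w j * x $ j * (\<sigma> x ^ k j * root_derivative \<sigma> x)) = e * \<sigma> x"
    and ce: "\<And>i. c i + e * of_int (i - a) = b"
  shows "(\<Sum>j\<in>UNIV. w j * x $ j * pd j (tau k d (vector [n, a]) \<rho>' \<rho> lg) x)
    = b * tau k d (vector [n, a]) \<rho>' \<rho> lg x"
proof -
  let ?P = "\<lambda>n i. Phi k (vector [n, i]) x" and ?L = "\<lambda>m. power_integral \<rho>' \<rho> lg m x"
  let ?r = "\<lambda>j. \<rho> x ^ k j * root_derivative \<rho> x" and ?r' = "\<lambda>j. \<rho>' x ^ k j * root_derivative \<rho>' x"
  have "(\<Sum>j\<in>UNIV. w j * x $ j * pd j (tau k d (vector [n, a]) \<rho>' \<rho> lg) x)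
      = (\<Sum>j\<in>UNIV. \<Sum>i\<in>{0..int d * n}. w j * x $ j * (?P (n - 1) (i - int (k j)) * ?L (i - a)
          + ?P n i * (\<rho> x powi (i - a - 1) * ?r j - \<rho>' x powi (i - a - 1) * ?r' j)))"
    by (simp add: has_pd_imp_pd[OF has_pd_tau_raw[OF x]] sum_distrib_left)
  also have "\<dots> = (\<Sum>i\<in>{0..int d * n}. \<Sum>j\<in>UNIV. w j * x $ j * (?P (n - 1) (i - int (k j)) * ?L (i - a)
          + ?P n i * (\<rho> x powi (i - a - 1) * ?r j - \<rho>' x powi (i - a - 1) * ?r' j)))"
    by (rule sum.swap)
  also have "\<dots> = (\<Sum>i\<in>{0..int d * n}. ?P n i * (c i * ?L (i - a)
          + e * (\<rho> x powi (i - a - 1) * \<rho> x - \<rho>' x powi (i - a - 1) * \<rho>' x)))"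
  proof (rule sum.cong[OF refl])
    fix i
    have "(\<Sum>j\<in>UNIV. w j * x $ j * (?P (n - 1) (i - int (k j)) * ?L (i - a)
          + ?P n i * (\<rho> x powi (i - a - 1) * ?r j - \<rho>' x powi (i - a - 1) * ?r' j)))
      = (\<Sum>j\<in>UNIV. w j * x $ j * ?P (n - 1) (i - int (k j))) * ?L (i - a)
        + ?P n i * (\<rho> x powi (i - a - 1) * (\<Sum>j\<in>UNIV. w j * x $ j * ?r j)
          - \<rho>' x powi (i - a - 1) * (\<Sum>j\<in>UNIV. w j * x $ j * ?r' j))"
      unfolding sum_distrib_left sum_distrib_right sum_subtractf[symmetric] sum.distrib[symmetric]
      by (intro sum.cong) (simp_all add: algebra_simps)
    also have "\<dots> = ?P n i * (c i * ?L (i - a)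
          + e * (\<rho> x powi (i - a - 1) * \<rho> x - \<rho>' x powi (i - a - 1) * \<rho>' x))"
      unfolding Phi root[OF \<rho>] root[OF \<rho>'] by (simp add: algebra_simps)
    finally show "(\<Sum>j\<in>UNIV. w j * x $ j * (?P (n - 1) (i - int (k j)) * ?L (i - a)
          + ?P n i * (\<rho> x powi (i - a - 1) * ?r j - \<rho>' x powi (i - a - 1) * ?r' j)))
      = ?P n i * (c i * ?L (i - a)
          + e * (\<rho> x powi (i - a - 1) * \<rho> x - \<rho>' x powi (i - a - 1) * \<rho>' x))" .
  qed
  also have "\<dots> = (\<Sum>i\<in>{0..int d * n}. ?P n i * (b * ?L (i - a)))"
  proof (rule sum.cong[OF refl])
    fix i
    have "\<sigma> x powi (i - a - 1) * \<sigma> x = \<sigma> x powi (i - a)" if "\<sigma> \<in> roots_on k U" for \<sigma>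
      using root_value_nonzero[OF that x] by (simp add: power_int_diff)
    then have "\<rho> x powi (i - a - 1) * \<rho> x - \<rho>' x powi (i - a - 1) * \<rho>' x = of_int (i - a) * ?L (i - a)"
      using \<rho> \<rho>' by (auto simp: power_integral_def)
    then show "?P n i * (c i * ?L (i - a)
          + e * (\<rho> x powi (i - a - 1) * \<rho> x - \<rho>' x powi (i - a - 1) * \<rho>' x)) = ?P n i * (b * ?L (i - a))"
      by (simp only: ce[of i, symmetric] distrib_right mult.assoc)
  qed
  finally show ?thesis
    unfolding tau_eq_sum_power_integral by (simp add: sum_distrib_left mult.left_commute)
qed

lemma tau_Euler:
  assumes x: "x \<in> U"
  shows "(\<Sum>j\<in>UNIV. x $ j * pd j (tau k d (vector [n, a]) \<rho>' \<rho> lg) x)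
      = of_int n * tau k d (vector [n, a]) \<rho>' \<rho> lg x"
    "(\<Sum>j\<in>UNIV. of_nat (k j) * x $ j * pd j (tau k d (vector [n, a]) \<rho>' \<rho> lg) x)
      = of_int a * tau k d (vector [n, a]) \<rho>' \<rho> lg x"
proof -
  show "(\<Sum>j\<in>UNIV. x $ j * pd j (tau k d (vector [n, a]) \<rho>' \<rho> lg) x)
      = of_int n * tau k d (vector [n, a]) \<rho>' \<rho> lg x"
    using tau_weighted_Euler[OF x, where w = "\<lambda>_. 1" and n = n and c = "\<lambda>_. of_int n" and e = 0
        and a = a and b = "of_int n"] Phi_Euler(1)[of x k n] root_Euler(1)[OF _ x] by simp
  show "(\<Sum>j\<in>UNIV. of_nat (k j) * x $ j * pd j (tau k d (vector [n, a]) \<rho>' \<rho> lg) x)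
      = of_int a * tau k d (vector [n, a]) \<rho>' \<rho> lg x"
    by (rule tau_weighted_Euler[OF x, where c = of_int and e = "- 1", OF Phi_Euler(2)])
      (simp_all add: root_Euler(2)[OF _ x])
qed

end

section \<open>Shift families and the toric equations\<close>

text \<open>
  The coordinate \<open>x\<^sub>0\<close> has exponent \<open>0\<close>, so \<open>\<partial>\<^sub>0\<close> can serve as the normal form of all \<open>\<partial>\<^sub>j\<close>.
\<close>

definition shift_family :: "(int \<Rightarrow> complex ^ 'n::{finite,linorder} \<Rightarrow> complex) \<Rightarrow> bool" where
  "shift_family F \<longleftrightarrow> (\<forall>a. holo_on (F a) U) \<and>
     (\<forall>a j. \<forall>x\<in>U. pd j (F a) x = pd j0 (F (a - int (k j))) x)"

lemma shift_familyD:
  assumes "shift_family F"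
  shows "holo_on (F a) U" "x \<in> U \<Longrightarrow> pd j (F a) x = pd j0 (F (a - int (k j))) x"
  using assms unfolding shift_family_def by blast+

lemma pd_funpow_shift_family:
  assumes F: "shift_family F" and x: "x \<in> U"
  shows "pd j ((pd j0 ^^ r) (F a)) x = (pd j0 ^^ Suc r) (F (a - int (k j))) x"
proof -
  have "sep_holo_on (F a) U"
    by (rule holo_on_imp_sep_holo_on[OF shift_familyD(1)[OF F] open_U])
  then have "pd j ((pd j0 ^^ r) (F a)) x = (pd j0 ^^ r) (pd j (F a)) x"
    using open_U x by (rule pd_funpow_commute)
  also have "\<dots> = (pd j0 ^^ r) (pd j0 (F (a - int (k j)))) x"
    by (rule funpow_pd_cong[OF open_U shift_familyD(2)[OF F] x])
  finally show ?thesis by (simp add: funpow_swap1)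
qed

lemma funpow_pd_shift_family:
  assumes F: "shift_family F" and x: "x \<in> U"
  shows "(pd j ^^ m) ((pd j0 ^^ r) (F a)) x = (pd j0 ^^ (m + r)) (F (a - int (k j * m))) x"
  using x
proof (induction m arbitrary: x)
  case (Suc m)
  have "(pd j ^^ Suc m) ((pd j0 ^^ r) (F a)) x = pd j ((pd j0 ^^ (m + r)) (F (a - int (k j * m)))) x"
    using pd_cong[OF open_U Suc.prems Suc.IH, where j = j] by simp
  also have "\<dots> = (pd j0 ^^ (Suc m + r)) (F (a - int (k j * Suc m))) x"
    unfolding pd_funpow_shift_family[OF F Suc.prems] by (simp add: algebra_simps)
  finally show ?case .
qed simp

text \<open>
  Each \<open>\<partial>\<^sub>j\<close> is moved past the \<open>\<partial>\<^sub>0\<close> already collected and then traded for one more \<open>\<partial>\<^sub>0\<close> and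
  a shift by \<open>k\<^sub>j\<close>.
\<close>

lemma mpd_shift_family:
  assumes F: "shift_family F" and x: "x \<in> U"
  shows "mpd n (F a) x = (pd j0 ^^ (\<Sum>j\<in>UNIV. n j)) (F (a - int (\<Sum>j\<in>UNIV. k j * n j))) x"
proof -
  have "fold (\<lambda>j. pd j ^^ n j) js \<phi> y
      = (pd j0 ^^ (sum_list (map n js) + r)) (F (a - int (sum_list (map (\<lambda>j. k j * n j) js)))) y"
    if "y \<in> U" "\<And>y. y \<in> U \<Longrightarrow> \<phi> y = (pd j0 ^^ r) (F a) y" for js \<phi> r a y
    using that
  proof (induction js arbitrary: \<phi> r a)
    case (Cons j js)
    have step: "(pd j ^^ n j) \<phi> z = (pd j0 ^^ (n j + r)) (F (a - int (k j * n j))) z" if "z \<in> U" for z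
      using funpow_pd_cong[OF open_U Cons.prems(2) that] funpow_pd_shift_family[OF F that] by simp
    show ?case
      using Cons.IH[OF Cons.prems(1) step] by (simp add: algebra_simps)
  qed simp
  from this[OF x, where \<phi> = "F a" and r = 0 and a = a and js = "sorted_list_of_set UNIV"]
  show ?thesis
    unfolding mpd_def by (simp add: sum_list_distinct_conv_sum_set)
qed

text \<open>
  The two rows of \<open>\<A>v = 0\<close> say that the positive and the negative part of \<open>v\<close> have the same
  total and the same weighted total.
\<close>

lemma shift_family_toric:
  assumes F: "shift_family F" and x: "x \<in> U" and v: "mat_A k *v v = 0"
  shows "mpd (\<lambda>j. nat (v $ j)) (F a) x = mpd (\<lambda>j. nat (- v $ j)) (F a) x"
proof -
  \<comment> \<open>Natural-number totals of the two parts of \<open>v\<close> are compared through their integer difference.\<close>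
  have diff: "int (nat z) - int (nat (- z)) = z" for z by simp
  have "int (\<Sum>j\<in>UNIV. nat (v $ j)) - int (\<Sum>j\<in>UNIV. nat (- v $ j)) = (\<Sum>j\<in>UNIV. v $ j)"
    by (simp only: of_nat_sum sum_subtractf[symmetric] diff)
  moreover have "int (\<Sum>j\<in>UNIV. k j * nat (v $ j)) - int (\<Sum>j\<in>UNIV. k j * nat (- v $ j))
      = (\<Sum>j\<in>UNIV. int (k j) * v $ j)"
    by (simp only: of_nat_sum of_nat_mult sum_subtractf[symmetric] right_diff_distrib[symmetric] diff)
  moreover have "(\<Sum>j\<in>UNIV. v $ j) = 0" "(\<Sum>j\<in>UNIV. int (k j) * v $ j) = 0"
    using v unfolding mat_A_vec_eq_iff by simp_all
  ultimately have "int (\<Sum>j\<in>UNIV. nat (v $ j)) = int (\<Sum>j\<in>UNIV. nat (- v $ j))"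
    "int (\<Sum>j\<in>UNIV. k j * nat (v $ j)) = int (\<Sum>j\<in>UNIV. k j * nat (- v $ j))"
    by linarith+
  then have "(\<Sum>j\<in>UNIV. nat (v $ j)) = (\<Sum>j\<in>UNIV. nat (- v $ j))"
    "(\<Sum>j\<in>UNIV. k j * nat (v $ j)) = (\<Sum>j\<in>UNIV. k j * nat (- v $ j))"
    by (simp_all only: of_nat_eq_iff)
  then show ?thesis
    unfolding mpd_shift_family[OF F x] by simp
qed

lemma shift_family_Phi: "shift_family (\<lambda>a. Phi k (vector [n, a]))"
  unfolding shift_family_def
  by (auto simp: holo_on_Phi has_pd_imp_pd[OF has_pd_Phi] k_j0)

lemma shift_family_tau:
  assumes "\<rho>' \<in> roots_on k U" "\<rho> \<in> roots_on k U" "log_branch_on U \<rho>' \<rho> lg"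
  shows "shift_family (\<lambda>a. tau k d (vector [n, a]) \<rho>' \<rho> lg)"
  unfolding shift_family_def
  using holo_on_tau[OF assms] has_pd_imp_pd[OF has_pd_tau[OF assms]] by (auto simp: k_j0)

lemma pd_sum_cmult:
  assumes "\<And>i. i \<in> S \<Longrightarrow> holo_on (F i) U" "x \<in> U"
  shows "pd j (\<lambda>y. \<Sum>i\<in>S. c i * F i y) x = (\<Sum>i\<in>S. c i * pd j (F i) x)"
  using holo_on_imp_has_pd[OF assms(1) open_U assms(2)]
  by (intro has_pd_imp_pd has_pd_sum has_pd_cmult) auto

lemma shift_family_sum:
  assumes "\<And>i. i \<in> S \<Longrightarrow> shift_family (F i)"
  shows "shift_family (\<lambda>a y. \<Sum>i\<in>S. c i * F i a y)"
proof -
  have holo: "holo_on (F i a) U" if "i \<in> S" for i a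
    by (rule shift_familyD(1)[OF assms[OF that]])
  have "pd j (\<lambda>y. \<Sum>i\<in>S. c i * F i a y) x = pd j0 (\<lambda>y. \<Sum>i\<in>S. c i * F i (a - int (k j)) y) x"
    if "x \<in> U" for a j x
  proof -
    have "pd j (\<lambda>y. \<Sum>i\<in>S. c i * F i a y) x = (\<Sum>i\<in>S. c i * pd j (F i a) x)"
      by (rule pd_sum_cmult[OF holo that])
    also have "\<dots> = (\<Sum>i\<in>S. c i * pd j0 (F i (a - int (k j))) x)"
      by (intro sum.cong refl arg_cong[of _ _ "(*) _"] shift_familyD(2)[OF assms that])
    also have "\<dots> = pd j0 (\<lambda>y. \<Sum>i\<in>S. c i * F i (a - int (k j)) y) x"
      by (rule pd_sum_cmult[OF holo that, symmetric])
    finally show ?thesis .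
  qed
  then show ?thesis
    unfolding shift_family_def using holo by (intro conjI allI ballI holo_on_sum holo_on_cmult)
qed

lemma A_hypergeometric_onI:
  fixes \<alpha> :: "int ^ 2"
  assumes F: "shift_family F"
    and "\<And>x. x \<in> U \<Longrightarrow> (\<Sum>j\<in>UNIV. x $ j * pd j (F a) x) = of_int (\<alpha> $ 1) * F a x"
    and "\<And>x. x \<in> U \<Longrightarrow> (\<Sum>j\<in>UNIV. of_nat (k j) * x $ j * pd j (F a) x) = of_int (\<alpha> $ 2) * F a x"
  shows "A_hypergeometric_on k U (\<chi> i. of_int (\<alpha> $ i)) (F a)"
  unfolding A_hypergeometric_on_def
proof (intro conjI ballI allI impI)
  show "holo_on (F a) U" by (rule shift_familyD(1)[OF F])
  show "mpd (\<lambda>j. nat (v $ j)) (F a) x = mpd (\<lambda>j. nat (- v $ j)) (F a) x"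
    if "mat_A k *v v = 0" "x \<in> U" for v x
    by (rule shift_family_toric[OF F that(2,1)])
qed (simp_all add: assms(2,3))

end

section \<open>Numerical semigroups\<close>

text \<open>
  The additive submonoid generated by \<open>A\<close>, built by adding one generator at a time as this is how
  derivatives are applied.
\<close>

inductive_set submonoid :: "nat set \<Rightarrow> nat set" for A where
  submonoid_0: "0 \<in> submonoid A"
| submonoid_step: "s \<in> submonoid A \<Longrightarrow> a \<in> A \<Longrightarrow> s + a \<in> submonoid A"

lemma submonoid_add:
  assumes s: "s \<in> submonoid A" and t: "t \<in> submonoid A"
  shows "s + t \<in> submonoid A"
  using t by induction (auto simp flip: add.assoc intro: s submonoid.intros)

lemma submonoid_mult: "s \<in> submonoid A \<Longrightarrow> m * s \<in> submonoid A"
  by (induction m) (auto intro: submonoid_0 submonoid_add)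

text \<open>
  The differences of elements form a subgroup of the integers whose positive generator \<open>g\<close> divides
  all of \<open>A\<close>; hence \<open>g = 1\<close>, so two consecutive numbers \<open>t\<close> and \<open>t + 1\<close> lie in the submonoid, and
  these two represent every \<open>m \<ge> t\<^sup>2\<close>.
\<close>

lemma eventually_in_submonoid:
  assumes "Gcd A = (1 :: nat)"
  shows "\<exists>C. \<forall>s\<ge>C. s \<in> submonoid A"
proof -
  define H where "H = {int s - int t | s t. s \<in> submonoid A \<and> t \<in> submonoid A}"
  have H_diff: "z - w \<in> H" if zw: "z \<in> H" "w \<in> H" for z w
  proof -
    obtain s t s' t' where "s \<in> submonoid A" "t \<in> submonoid A" "s' \<in> submonoid A" "t' \<in> submonoid A"
      "z = int s - int t" "w = int s' - int t'"
      using zw unfolding H_def by blast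
    then have "s + t' \<in> submonoid A" "t + s' \<in> submonoid A" "z - w = int (s + t') - int (t + s')"
      by (auto intro: submonoid_add)
    then show ?thesis unfolding H_def by blast
  qed
  have zero_H: "0 \<in> H" unfolding H_def using submonoid_0[of A] by force
  have H_mult: "int m * z \<in> H" if "z \<in> H" for m z
  proof (induction m)
    case (Suc m)
    have "0 - z \<in> H" using zero_H that by (rule H_diff)
    with Suc have "int m * z - (0 - z) \<in> H" by (rule H_diff)
    then show ?case by (simp add: algebra_simps)
  qed (simp add: zero_H)
  have A_H: "int a \<in> H" if "a \<in> A" for a
  proof -
    have "0 + a \<in> submonoid A" using that by (intro submonoid_step submonoid_0)
    then show ?thesis unfolding H_def using submonoid_0[of A] by force
  qed
  obtain a0 where a0: "a0 \<in> A" "a0 > 0"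
  proof (rule ccontr)
    assume "\<not> thesis"
    then have "A \<subseteq> {0}" using that by auto
    then have "Gcd A = 0" by (simp add: Gcd_0_iff)
    with assms show False by simp
  qed
  \<comment> \<open>The least positive element generates the subgroup \<open>H\<close>.\<close>
  define g where "g = (LEAST g. 0 < g \<and> int g \<in> H)"
  have "0 < g \<and> int g \<in> H"
    unfolding g_def by (rule LeastI[of _ a0]) (use a0 A_H in auto)
  moreover have g_least: "g \<le> h" if "0 < h" "int h \<in> H" for h
    unfolding g_def using that by (intro Least_le) auto
  ultimately have g: "0 < g" "int g \<in> H" by auto
  have "g dvd a" if "a \<in> A" for a
  proof (rule ccontr)
    assume "\<not> g dvd a"
    then have "0 < a mod g" by (simp add: dvd_eq_mod_eq_0)
    moreover have "int (a mod g) \<in> H"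
    proof -
      have "int a - int (a div g) * int g \<in> H"
        by (intro H_diff H_mult g A_H that)
      also have "int a - int (a div g) * int g = int (a mod g)"
        by (metis add_diff_cancel_left' div_mult_mod_eq of_nat_add of_nat_mult)
      finally show ?thesis .
    qed
    ultimately show False using g_least[of "a mod g"] mod_less_divisor[OF g(1), of a] by linarith
  qed
  then have "g dvd Gcd A" by (intro Gcd_greatest)
  then have "g = 1" using assms by simp
  then have "1 \<in> H" using g(2) by simp
  then obtain s t where st: "s \<in> submonoid A" "t \<in> submonoid A" "1 = int s - int t"
    unfolding H_def by blast
  then have s: "s = Suc t" by simp
  have "m \<in> submonoid A" if m: "m \<ge> t * t" for m
  proof (cases "t = 0")
    case True
    then show ?thesis using submonoid_mult[of s A m] st s by simp
  next
    case False
    define q r where "q = m div t" and "r = m mod t"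
    have "t \<le> q" using m False unfolding q_def by (simp add: div_le_mono less_eq_div_iff_mult_less_eq)
    moreover have "r < t" using False by (simp add: r_def)
    ultimately have "(q - r) * t + r * Suc t = q * t + r"
      by (simp add: algebra_simps diff_mult_distrib)
    also have "\<dots> = m" by (simp add: q_def r_def)
    finally show ?thesis
      using submonoid_add[OF submonoid_mult[OF st(2), of "q - r"] submonoid_mult[OF st(1), of r]] s by simp
  qed
  then show ?thesis by blast
qed

section \<open>Linear independence\<close>

lemma deriv_funpow_line:
  assumes \<phi>: "sep_holo_on \<phi> U" and "open U" and "x + axis j \<zeta> \<in> U"
  shows "(deriv ^^ r) (\<lambda>\<zeta>. \<phi> (x + axis j \<zeta>)) \<zeta> = (pd j ^^ r) \<phi> (x + axis j \<zeta>)"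
  using assms(3)
proof (induction r arbitrary: \<zeta>)
  case (Suc r)
  have "open ((\<lambda>\<zeta>. x + axis j \<zeta>) -` U)"
    by (rule open_vimage[OF assms(2)]) (intro continuous_intros)
  then have "eventually (\<lambda>\<zeta>. \<zeta> \<in> (\<lambda>\<zeta>. x + axis j \<zeta>) -` U) (nhds \<zeta>)"
    by (rule eventually_nhds_in_open) (use Suc.prems in simp)
  then have "eventually (\<lambda>\<zeta>. (deriv ^^ r) (\<lambda>\<zeta>. \<phi> (x + axis j \<zeta>)) \<zeta> = (pd j ^^ r) \<phi> (x + axis j \<zeta>)) (nhds \<zeta>)"
    by (rule eventually_mono) (simp add: Suc.IH)
  then have "(deriv ^^ Suc r) (\<lambda>\<zeta>. \<phi> (x + axis j \<zeta>)) \<zeta> = deriv (\<lambda>\<zeta>. (pd j ^^ r) \<phi> (x + axis j \<zeta>)) \<zeta>"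
    by (simp add: deriv_cong_ev)
  also have "\<dots> = (pd j ^^ Suc r) \<phi> (x + axis j \<zeta>)"
    using sep_holo_on_funpow_pd[OF \<phi> assms(2), where j = j and r = r] Suc.prems
    unfolding sep_holo_on_def
    by (intro DERIV_imp_deriv) (simp add: has_field_derivative_line_iff)
  finally show ?case .
qed simp

lemma funpow_pd_vanish:
  assumes "open U" "\<And>y. y \<in> U \<Longrightarrow> \<phi> y = 0" "x \<in> U"
  shows "(pd j ^^ r) \<phi> x = 0"
proof -
  have zero: "(pd j ^^ r) (\<lambda>_. 0) = (\<lambda>_. 0)" for j :: 'a and r
  proof -
    have "pd j (\<lambda>_. 0) = (\<lambda>_. 0)"
      by (rule ext) (rule has_pd_imp_pd[OF has_pd_const])
    then show ?thesis by (induction r) simp_all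
  qed
  show ?thesis
    using funpow_pd_cong[OF assms(1), of \<phi> "\<lambda>_. 0" x r j] assms(2,3) by (simp add: zero)
qed

text \<open>
  All Taylor coefficients of degree at least \<open>r\<close> at the centre vanish.
\<close>

lemma polynomial_on_line:
  assumes \<phi>: "sep_holo_on \<phi> U" and "open U"
    and ball: "\<And>\<zeta>. \<zeta> \<in> ball 0 \<delta> \<Longrightarrow> x + axis j \<zeta> \<in> U"
    and vanish: "\<And>y. y \<in> U \<Longrightarrow> (pd j ^^ r) \<phi> y = 0"
  shows "\<exists>p. \<forall>\<zeta>\<in>ball 0 \<delta>. \<phi> (x + axis j \<zeta>) = poly p \<zeta>"
proof (intro exI ballI)
  fix \<zeta> :: complex assume \<zeta>: "\<zeta> \<in> ball 0 \<delta>"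
  define g where "g = (\<lambda>\<zeta>. \<phi> (x + axis j \<zeta>))"
  define c where "c n = (deriv ^^ n) g 0 / fact n" for n
  have "0 \<in> ball (0 :: complex) \<delta>" using \<zeta> by (auto intro: le_less_trans[OF norm_ge_zero])
  then have xU: "x + axis j 0 \<in> U" by (rule ball)
  have "c n = 0" if "n \<ge> r" for n
  proof -
    have "(pd j ^^ n) \<phi> (x + axis j 0) = (pd j ^^ (n - r)) ((pd j ^^ r) \<phi>) (x + axis j 0)"
      using that by (simp flip: funpow_add[THEN fun_cong, unfolded comp_def])
    also have "\<dots> = 0"
      by (rule funpow_pd_vanish[OF assms(2) vanish xU])
    finally show ?thesis
      using deriv_funpow_line[OF \<phi> assms(2) xU, of n] by (simp add: c_def g_def)
  qed
  then have "(\<lambda>n. c n * \<zeta> ^ n) sums (\<Sum>n<r. c n * \<zeta> ^ n)"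
    by (intro sums_finite) (auto simp: not_less)
  moreover have "(\<lambda>n. c n * (\<zeta> - 0) ^ n) sums g \<zeta>"
    unfolding c_def g_def
    by (rule holomorphic_power_series[OF sep_holo_on_line[OF \<phi> ball] \<zeta>])
  ultimately have "g \<zeta> = (\<Sum>n<r. c n * \<zeta> ^ n)"
    by (simp add: sums_unique2)
  then show "\<phi> (x + axis j \<zeta>) = poly (\<Sum>n<r. monom ((deriv ^^ n) (\<lambda>\<zeta>. \<phi> (x + axis j \<zeta>)) 0 / fact n) n) \<zeta>"
    by (simp add: g_def c_def poly_sum poly_monom)
qed

text \<open>
  Relations are indexed by \<open>None\<close> for \<open>\<Phi>\<close> and \<open>Some \<rho>\<close> for \<open>\<tau>\<^sub>\<rho>\<close>; this separates the two.
\<close>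

lemma sum_option_family:
  fixes h :: "'b option \<Rightarrow> complex"
  assumes "finite S"
  shows "(\<Sum>i\<in>S. h i) = (if None \<in> S then h None else 0) + (\<Sum>b\<in>{b. Some b \<in> S}. h (Some b))"
proof -
  have S: "S = (S \<inter> {None}) \<union> Some ` {b. Some b \<in> S}"
    by (auto simp: image_iff) (metis not_None_eq)
  have "finite (Some ` {b. Some b \<in> S})"
    using assms by (rule finite_subset[rotated]) auto
  then have "(\<Sum>i\<in>S. h i) = (\<Sum>i\<in>S \<inter> {None}. h i) + (\<Sum>i\<in>Some ` {b. Some b \<in> S}. h i)"
    using assms by (subst S, intro sum.union_disjoint) auto
  then show ?thesis by (simp add: sum.reindex)
qed

context hypergeometric_domain
begin

text \<open>
  The polynomial \<open>(f(x;s) - f(x;t)) / (s - t)\<close>.  As \<open>k\<close> vanishes at the smallest index, it does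
  not involve \<open>x\<^sub>0\<close>.
\<close>

definition divided_difference :: "complex ^ 'n::{finite,linorder} \<Rightarrow> complex \<Rightarrow> complex \<Rightarrow> complex" where
  "divided_difference x s t = (\<Sum>j\<in>UNIV. x $ j * (\<Sum>m<k j. t ^ (k j - Suc m) * s ^ m))"

lemma f_poly_diff:
  "poly (f_poly k x) s - poly (f_poly k x) t = (s - t) * divided_difference x s t"
  unfolding poly_f_poly divided_difference_def sum_subtractf[symmetric] right_diff_distrib[symmetric]
    power_diff_sumr2
  by (simp add: sum_distrib_left mult.left_commute)

lemma divided_difference_diag: "divided_difference x t t = poly (pderiv (f_poly k x)) t"
  unfolding poly_pderiv_f_poly divided_difference_def
proof (intro sum.cong refl arg_cong[of _ _ "(*) _"])
  fix j
  have "(\<Sum>m<k j. t ^ (k j - Suc m) * t ^ m) = (\<Sum>m<k j. t ^ (k j - 1))"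
    by (intro sum.cong refl) (simp flip: power_add)
  then show "(\<Sum>m<k j. t ^ (k j - Suc m) * t ^ m) = of_nat (k j) * t ^ (k j - 1)" by simp
qed

lemma root_eq_iff_divided_difference:
  assumes "\<rho> \<in> roots_on k U" "\<sigma> \<in> roots_on k U" "x \<in> U"
  shows "\<rho> x = \<sigma> x \<longleftrightarrow> divided_difference x (\<rho> x) (\<sigma> x) \<noteq> 0"
proof
  assume "\<rho> x = \<sigma> x"
  then show "divided_difference x (\<rho> x) (\<sigma> x) \<noteq> 0"
    using root_simple[OF assms(3) root_eq[OF assms(2,3)]] by (simp add: divided_difference_diag)
next
  assume "divided_difference x (\<rho> x) (\<sigma> x) \<noteq> 0"
  then show "\<rho> x = \<sigma> x"
    using f_poly_diff[of x "\<rho> x" "\<sigma> x"] root_eq[OF assms(1,3)] root_eq[OF assms(2,3)] by simp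
qed

text \<open>
  For two roots, \<open>(\<rho> - \<sigma>)\<close> times their divided difference is \<open>0\<close>, while both factors cannot vanish
  together since roots are simple.  So the coincidence set and its complement are both given by the
  nonvanishing of a continuous function, and one of them is empty by connectedness.
\<close>

lemma roots_pointwise_distinct:
  assumes conn: "connected U" and \<rho>: "\<rho> \<in> roots_on k U" and \<sigma>: "\<sigma> \<in> roots_on k U" and x: "x \<in> U"
    and eq: "\<rho> x = \<sigma> x"
  shows "\<rho> = \<sigma>"
proof -
  have cont: "continuous_on U \<tau>" if "\<tau> \<in> roots_on k U" for \<tau>
    using holo_on_imp_sep_holo_on[OF root_holo[OF that] open_U] unfolding sep_holo_on_def by blast
  let ?A = "U \<inter> (\<lambda>y. divided_difference y (\<rho> y) (\<sigma> y)) -` (- {0})" and ?B = "U \<inter> (\<lambda>y. \<rho> y - \<sigma> y) -` (- {0})"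
  have "continuous_on U (\<lambda>y. divided_difference y (\<rho> y) (\<sigma> y))"
    unfolding divided_difference_def by (intro continuous_intros cont \<rho> \<sigma>)
  then have "open ?A" by (rule continuous_open_preimage[OF _ open_U]) auto
  moreover have "open ?B"
    by (rule continuous_open_preimage[OF continuous_on_diff[OF cont[OF \<rho>] cont[OF \<sigma>]] open_U]) auto
  moreover have "U \<subseteq> ?A \<union> ?B" "?A \<inter> ?B \<inter> U = {}"
    using root_eq_iff_divided_difference[OF \<rho> \<sigma>] by auto
  ultimately have "?A \<inter> U = {} \<or> ?B \<inter> U = {}"
    using connectedD[OF conn, of ?A ?B] by blast
  moreover have "x \<in> ?A" using root_eq_iff_divided_difference[OF \<rho> \<sigma> x] eq x by simp
  ultimately have "\<rho> y = \<sigma> y" if "y \<in> U" for y using that by auto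
  then show ?thesis
    using \<rho> \<sigma> unfolding roots_on_def by (auto intro: extensionalityI)
qed

text \<open>
  On the line \<open>x + axis j0 \<zeta>\<close> only the constant coefficient of \<open>f\<close> moves, so \<open>\<zeta> = - f(x;t)\<close> for
  every root \<open>t\<close>.  Consider \<open>\<Sum>\<^sub>\<rho> c\<^sub>\<rho> \<rho>\<^sup>C (f(t) - f(\<rho>)) / (t - \<rho>)\<close>.  Its coefficients are weighted
  power sums with exponents at least \<open>C\<close>, hence polynomials in \<open>\<zeta>\<close>, and replacing \<open>\<zeta>\<close> by \<open>- f(x;t)\<close>
  turns it into a polynomial \<open>W\<close> in \<open>t\<close> alone.  At a root \<open>t = \<sigma>\<close> all summands but the one of \<open>\<sigma>\<close>
  vanish, leaving \<open>W(t) = c\<^sub>\<sigma> t\<^sup>C f'(t)\<close>.  A root takes infinitely many values along the line, so this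
  is an identity of polynomials, and \<open>W\<close> determines \<open>c\<^sub>\<sigma>\<close>.
\<close>

lemma coefficients_equal:
  assumes conn: "connected U" and R: "finite R" "R \<subseteq> roots_on k U"
    and \<delta>: "\<delta> > 0" "\<And>\<zeta>. \<zeta> \<in> ball 0 \<delta> \<Longrightarrow> x + axis j0 \<zeta> \<in> U"
    and power_sums: "\<And>s. s \<ge> C \<Longrightarrow>
      \<exists>p. \<forall>\<zeta>\<in>ball 0 \<delta>. (\<Sum>\<rho>\<in>R. c \<rho> * \<rho> (x + axis j0 \<zeta>) ^ s) = poly p \<zeta>"
    and "\<rho> \<in> R" "\<sigma> \<in> R"
  shows "c \<rho> = c \<sigma>"
proof -
  have "\<forall>s. \<exists>p. s \<ge> C \<longrightarrow> (\<forall>\<zeta>\<in>ball 0 \<delta>. (\<Sum>\<rho>\<in>R. c \<rho> * \<rho> (x + axis j0 \<zeta>) ^ s) = poly p \<zeta>)"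
    using power_sums by blast
  from choice[OF this] obtain p where p: "\<And>s \<zeta>. s \<ge> C \<Longrightarrow> \<zeta> \<in> ball 0 \<delta> \<Longrightarrow>
      (\<Sum>\<rho>\<in>R. c \<rho> * \<rho> (x + axis j0 \<zeta>) ^ s) = poly (p s) \<zeta>"
    by blast
  define y where "y \<zeta> = x + axis j0 \<zeta>" for \<zeta>
  have y_U: "y \<zeta> \<in> U" if "\<zeta> \<in> ball 0 \<delta>" for \<zeta>
    using \<delta>(2)[OF that] by (simp add: y_def)
  let ?f = "f_poly k x"
  have f_y: "poly (f_poly k (y \<zeta>)) t = poly ?f t + \<zeta>" for \<zeta> t
  proof -
    have "poly (f_poly k (y \<zeta>)) t = (\<Sum>j\<in>UNIV. x $ j * t ^ k j + (if j = j0 then \<zeta> else 0))"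
      unfolding poly_f_poly y_def by (intro sum.cong refl) (auto simp: axis_def k_j0)
    then show ?thesis by (simp add: sum.distrib poly_f_poly)
  qed
  have f'_y: "poly (pderiv (f_poly k (y \<zeta>))) t = poly (pderiv ?f) t" for \<zeta> t
    unfolding poly_pderiv_f_poly y_def by (intro sum.cong refl) (auto simp: axis_def k_j0)
  define W where "W = (\<Sum>j\<in>UNIV. \<Sum>m<k j.
      smult (x $ j) (monom 1 m * pcompose (p (C + (k j - Suc m))) (- ?f)))"
  have root_W: "poly W (\<sigma> (y \<zeta>)) = c \<sigma> * (\<sigma> (y \<zeta>) ^ C * poly (pderiv ?f) (\<sigma> (y \<zeta>)))"
    and root_f: "\<zeta> = - poly ?f (\<sigma> (y \<zeta>))" if \<zeta>: "\<zeta> \<in> ball 0 \<delta>" and \<sigma>: "\<sigma> \<in> R" for \<zeta> \<sigma>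
  proof -
    define t where "t = \<sigma> (y \<zeta>)"
    have \<sigma>_root: "\<sigma> \<in> roots_on k U" using \<sigma> R(2) by blast
    show f_t: "\<zeta> = - poly ?f (\<sigma> (y \<zeta>))"
      using root_eq[OF \<sigma>_root y_U[OF \<zeta>]] unfolding f_y by (simp add: eq_neg_iff_add_eq_0 add.commute)
    have "poly W t = (\<Sum>j\<in>UNIV. \<Sum>m<k j. x $ j * (t ^ m * poly (p (C + (k j - Suc m))) \<zeta>))"
      unfolding W_def using f_t by (simp add: poly_sum poly_monom poly_pcompose t_def)
    also have "\<dots> = (\<Sum>j\<in>UNIV. \<Sum>m<k j. x $ j * (t ^ m * (\<Sum>\<rho>\<in>R. c \<rho> * \<rho> (y \<zeta>) ^ (C + (k j - Suc m)))))"
      using p[OF _ \<zeta>] by (simp add: y_def)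
    also have "\<dots> = (\<Sum>j\<in>UNIV. \<Sum>\<rho>\<in>R. \<Sum>m<k j. x $ j * (t ^ m * (c \<rho> * \<rho> (y \<zeta>) ^ (C + (k j - Suc m)))))"
      by (simp only: sum_distrib_left sum.swap[of _ R])
    also have "\<dots> = (\<Sum>\<rho>\<in>R. \<Sum>j\<in>UNIV. \<Sum>m<k j. x $ j * (t ^ m * (c \<rho> * \<rho> (y \<zeta>) ^ (C + (k j - Suc m)))))"
      by (rule sum.swap)
    also have "\<dots> = (\<Sum>\<rho>\<in>R. c \<rho> * \<rho> (y \<zeta>) ^ C * divided_difference (y \<zeta>) t (\<rho> (y \<zeta>)))"
    proof (rule sum.cong[OF refl])
      fix \<rho>
      have "(\<Sum>m<k j. x $ j * (t ^ m * (c \<rho> * \<rho> (y \<zeta>) ^ (C + (k j - Suc m)))))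
          = c \<rho> * \<rho> (y \<zeta>) ^ C * (y \<zeta> $ j * (\<Sum>m<k j. \<rho> (y \<zeta>) ^ (k j - Suc m) * t ^ m))" for j
      proof (cases "j = j0")
        case True
        then show ?thesis by (simp add: k_j0)
      next
        case False
        then have "y \<zeta> $ j = x $ j" by (simp add: y_def axis_def)
        then show ?thesis
          unfolding sum_distrib_left by (intro sum.cong refl) (simp only: power_add mult_ac)
      qed
      then show "(\<Sum>j\<in>UNIV. \<Sum>m<k j. x $ j * (t ^ m * (c \<rho> * \<rho> (y \<zeta>) ^ (C + (k j - Suc m)))))
          = c \<rho> * \<rho> (y \<zeta>) ^ C * divided_difference (y \<zeta>) t (\<rho> (y \<zeta>))"
        unfolding divided_difference_def by (simp add: sum_distrib_left)
    qed
    also have "\<dots> = (\<Sum>\<rho>\<in>R. if \<rho> = \<sigma> then c \<sigma> * (t ^ C * poly (pderiv ?f) t) else 0)"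
    proof (rule sum.cong[OF refl])
      fix \<rho> assume "\<rho> \<in> R"
      then have \<rho>_root: "\<rho> \<in> roots_on k U" using R(2) by blast
      have "divided_difference (y \<zeta>) t (\<rho> (y \<zeta>)) = 0" if "\<rho> \<noteq> \<sigma>"
        using root_eq_iff_divided_difference[OF \<sigma>_root \<rho>_root y_U[OF \<zeta>]]
          roots_pointwise_distinct[OF conn \<rho>_root \<sigma>_root y_U[OF \<zeta>]] that unfolding t_def by metis
      then show "c \<rho> * \<rho> (y \<zeta>) ^ C * divided_difference (y \<zeta>) t (\<rho> (y \<zeta>))
          = (if \<rho> = \<sigma> then c \<sigma> * (t ^ C * poly (pderiv ?f) t) else 0)"
        by (auto simp: t_def[symmetric] divided_difference_diag f'_y)
    qed
    also have "\<dots> = c \<sigma> * (t ^ C * poly (pderiv ?f) t)"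
      using R(1) \<sigma> by simp
    finally show "poly W (\<sigma> (y \<zeta>)) = c \<sigma> * (\<sigma> (y \<zeta>) ^ C * poly (pderiv ?f) (\<sigma> (y \<zeta>)))"
      unfolding t_def .
  qed
  have W: "W = smult (c \<sigma>) (monom 1 C * pderiv ?f)" if \<sigma>: "\<sigma> \<in> R" for \<sigma>
  proof -
    let ?D = "W - smult (c \<sigma>) (monom 1 C * pderiv ?f)"
    have "inj_on (\<lambda>\<zeta>. \<sigma> (y \<zeta>)) (ball 0 \<delta>)"
    proof (rule inj_onI)
      fix a b assume a: "a \<in> ball 0 \<delta>" and b: "b \<in> ball 0 \<delta>" and eq: "\<sigma> (y a) = \<sigma> (y b)"
      have "a = - poly ?f (\<sigma> (y a))" by (rule root_f[OF a \<sigma>])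
      also have "\<dots> = - poly ?f (\<sigma> (y b))" by (simp only: eq)
      also have "\<dots> = b" by (rule root_f[OF b \<sigma>, symmetric])
      finally show "a = b" .
    qed
    moreover have "infinite (ball (0 :: complex) \<delta>)"
      using finite_imp_not_open[of "ball (0 :: complex) \<delta>"] \<delta>(1) by auto
    ultimately have "infinite ((\<lambda>\<zeta>. \<sigma> (y \<zeta>)) ` ball 0 \<delta>)"
      using finite_imageD by blast
    moreover have "(\<lambda>\<zeta>. \<sigma> (y \<zeta>)) ` ball 0 \<delta> \<subseteq> {t. poly ?D t = 0}"
      using root_W[OF _ \<sigma>] by (auto simp: poly_monom)
    ultimately have "infinite {t. poly ?D t = 0}"
      using finite_subset by blast
    then have "?D = 0" using poly_roots_finite by blast
    then show ?thesis by simp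
  qed
  have "x \<in> U" using y_U[of 0] \<delta>(1) by (simp add: y_def)
  then have "pderiv ?f \<noteq> 0"
    using root_simple[of x "\<rho> x"] root_eq[of \<rho> x] R(2) \<open>\<rho> \<in> R\<close> by auto
  then have "monom 1 C * pderiv ?f \<noteq> 0" by (simp add: monom_eq_0_iff)
  moreover have "smult (c \<rho> - c \<sigma>) (monom 1 C * pderiv ?f) = 0"
    unfolding smult_diff_left W[OF \<open>\<rho> \<in> R\<close>, symmetric] W[OF \<open>\<sigma> \<in> R\<close>, symmetric] by simp
  ultimately show ?thesis by (simp only: smult_eq_0_iff) simp
qed

text \<open>
  Apply \<open>\<Prod>\<^sub>j \<partial>\<^sub>j^u\<^sub>j\<close>, one factor at a time; along the way the level stays positive until
  \<open>u\<close> is used up.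
\<close>

lemma relation_at_origin:
  fixes u :: "nat ^ 'n::{finite,linorder}"
  assumes step: "\<And>n a j x. n > 0 \<Longrightarrow> x \<in> U \<Longrightarrow> pd j (F n a) x = F (n - 1) (a - int (k j)) x"
    and "\<And>x. x \<in> U \<Longrightarrow> F (\<Sum>j\<in>UNIV. int (u $ j)) (\<Sum>j\<in>UNIV. int (k j) * int (u $ j)) x = 0"
    and "x \<in> U"
  shows "F 0 0 x = 0"
  using assms(2)
proof (induction "\<Sum>j\<in>UNIV. u $ j" arbitrary: u)
  case 0
  then have "u $ j = 0" for j by simp
  then show ?case using 0(2)[OF assms(3)] by simp
next
  case (Suc N)
  obtain j where j: "u $ j \<noteq> 0"
  proof (rule ccontr)
    assume "\<not> thesis"
    then have "(\<Sum>j\<in>UNIV. u $ j) = 0" using that by (intro sum.neutral) blast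
    with Suc.hyps(2) show False by simp
  qed
  define v where "v = u - axis j 1"
  have u: "u $ i = v $ i + (if i = j then 1 else 0)" for i
    using j by (auto simp: v_def axis_def)
  have split: "(\<Sum>i\<in>UNIV. w i * int (u $ i)) = (\<Sum>i\<in>UNIV. w i * int (v $ i)) + w j" for w
  proof -
    have "(\<Sum>i\<in>UNIV. w i * int (u $ i)) = (\<Sum>i\<in>UNIV. w i * int (v $ i) + (if i = j then w i else 0))"
      by (intro sum.cong) (auto simp: u algebra_simps)
    then show ?thesis by (simp add: sum.distrib)
  qed
  let ?n = "\<Sum>i\<in>UNIV. int (u $ i)" and ?a = "\<Sum>i\<in>UNIV. int (k i) * int (u $ i)"
  have n: "?n - 1 = (\<Sum>i\<in>UNIV. int (v $ i))" using split[of "\<lambda>_. 1"] by simp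
  have a: "?a - int (k j) = (\<Sum>i\<in>UNIV. int (k i) * int (v $ i))" using split[of "\<lambda>i. int (k i)"] by simp
  have pos: "?n > 0" using Suc.hyps(2) by (simp flip: of_nat_sum)
  show ?case
  proof (rule Suc.hyps(1))
    show "N = (\<Sum>j\<in>UNIV. v $ j)"
      using Suc.hyps(2) n by (simp flip: of_nat_sum)
    show "F (\<Sum>i\<in>UNIV. int (v $ i)) (\<Sum>i\<in>UNIV. int (k i) * int (v $ i)) y = 0" if y: "y \<in> U" for y
    proof -
      have "pd j (F ?n ?a) y = 0"
        using funpow_pd_vanish[OF open_U Suc.prems y, where r = 1] by simp
      then show ?thesis unfolding step[OF pos y] n a .
    qed
  qed
qed

text \<open>
  Starting from the relation at \<open>0\<close>, each further \<open>\<partial>\<^sub>j\<close> lowers the index by \<open>k\<^sub>j\<close> at the cost of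
  one more \<open>\<partial>\<^sub>0\<close>.
\<close>

lemma relation_along_submonoid:
  assumes F: "shift_family F" and zero: "\<And>x. x \<in> U \<Longrightarrow> F 0 x = 0"
    and s: "s \<in> submonoid (range k)"
  shows "\<exists>r. \<forall>x\<in>U. (pd j0 ^^ r) (F (- int s)) x = 0"
proof (rule submonoid.induct[OF s, where P = "\<lambda>s. \<exists>r. \<forall>x\<in>U. (pd j0 ^^ r) (F (- int s)) x = 0"])
  have "\<forall>x\<in>U. (pd j0 ^^ 0) (F (- int 0)) x = 0"
    unfolding funpow_0 of_nat_0 minus_zero using zero by blast
  then show "\<exists>r. \<forall>x\<in>U. (pd j0 ^^ r) (F (- int 0)) x = 0" ..
next
  fix s a assume "\<exists>r. \<forall>x\<in>U. (pd j0 ^^ r) (F (- int s)) x = 0" "a \<in> range k"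
  then obtain r j where r: "\<And>x. x \<in> U \<Longrightarrow> (pd j0 ^^ r) (F (- int s)) x = 0" and a: "a = k j"
    by blast
  have "(pd j0 ^^ Suc r) (F (- int (s + a))) x = 0" if x: "x \<in> U" for x
  proof -
    have "pd j ((pd j0 ^^ r) (F (- int s))) x = 0"
      using funpow_pd_vanish[OF open_U r x, where r = 1] by simp
    then show ?thesis
      unfolding pd_funpow_shift_family[OF F x] a by (simp add: algebra_simps)
  qed
  then show "\<exists>r. \<forall>x\<in>U. (pd j0 ^^ r) (F (- int (s + a))) x = 0" by blast
qed

lemma tau_level_0:
  "tau k d (vector [0, a]) \<rho>' \<rho> lg x = (if a = 0 then lg x else (\<rho> x powi (- a) - \<rho>' x powi (- a)) / of_int (- a))"
  unfolding tau_eq_sum_power_integral by (simp add: Phi_0 power_integral_def)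

text \<open>
  Differentiating a relation down to level \<open>0\<close> and further shows that powers of \<open>\<partial>\<^sub>0\<close> kill
  \<open>\<Sum>\<^sub>\<rho> c\<^sub>\<rho> (\<rho>\<^sup>s - \<rho>'\<^sup>s) / s\<close> for all large \<open>s\<close>.  Giving \<open>\<rho>'\<close> the coefficient minus the sum of the others turns it into a weighted power sum over all roots
  involved; \<open>coefficients_equal\<close> then forces equal weights, which add up to \<open>0\<close>.
\<close>

lemma Phi_tau_linearly_independent:
  assumes conn: "connected U" and "U \<noteq> {}"
    and \<alpha>: "\<alpha> \<in> I_A k" and \<rho>': "\<rho>' \<in> roots_on k U"
    and lg: "\<And>\<rho>. \<rho> \<in> roots_on k U - {\<rho>'} \<Longrightarrow> log_branch_on U \<rho>' \<rho> (lg \<rho>)"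
  shows "lin_indep_on U (insert None (Some ` (roots_on k U - {\<rho>'})))
    (\<lambda>i. case i of None \<Rightarrow> Phi k \<alpha> | Some \<rho> \<Rightarrow> tau k d \<alpha> \<rho>' \<rho> (lg \<rho>))"
  unfolding lin_indep_on_def
proof (intro allI impI, elim conjE)
  fix S :: "(complex ^ 'n::{finite,linorder} \<Rightarrow> complex) option set" and c
  assume S: "finite S" "S \<subseteq> insert None (Some ` (roots_on k U - {\<rho>'}))"
    and rel: "\<forall>x\<in>U. (\<Sum>i\<in>S. c i * (case i of None \<Rightarrow> Phi k \<alpha> | Some \<rho> \<Rightarrow> tau k d \<alpha> \<rho>' \<rho> (lg \<rho>)) x) = 0"
  define G where "G i n a = (case i of None \<Rightarrow> Phi k (vector [n, a])
    | Some \<rho> \<Rightarrow> tau k d (vector [n, a]) \<rho>' \<rho> (lg \<rho>))" for i n a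
  define F where "F n a = (\<lambda>x. \<Sum>i\<in>S. c i * G i n a x)" for n a
  define T where "T = {\<rho>. Some \<rho> \<in> S}"
  have T: "\<rho> \<in> roots_on k U" "\<rho> \<noteq> \<rho>'" if "\<rho> \<in> T" for \<rho>
    using S(2) that unfolding T_def by auto
  have "Some ` T \<subseteq> S" unfolding T_def by auto
  then have finite_T: "finite T"
    using S(1) by (meson finite_imageD finite_subset inj_Some inj_on_subset subset_UNIV)
  have G_cases: "i = None \<or> (\<exists>\<rho>\<in>T. i = Some \<rho>)" if "i \<in> S" for i
    using that unfolding T_def by (cases i) auto
  have lg_T: "log_branch_on U \<rho>' \<rho> (lg \<rho>)" if "\<rho> \<in> T" for \<rho>
    using lg T that by blast
  have shift_G: "shift_family (G i n)" if "i \<in> S" for i n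
    using G_cases[OF that] shift_family_Phi shift_family_tau[OF \<rho>' T(1) lg_T] unfolding G_def by auto
  have shift_F: "shift_family (F n)" for n
    unfolding F_def by (rule shift_family_sum[OF shift_G])
  have step_G: "pd j (G i n a) x = G i (n - 1) (a - int (k j)) x" if "i \<in> S" "n > 0" "x \<in> U" for i n a j x
    using G_cases[OF that(1)] has_pd_imp_pd[OF has_pd_Phi]
      has_pd_imp_pd[OF has_pd_tau[OF \<rho>' T(1) lg_T that(3)]]
      boundary_term_eq_0[OF \<rho>' T(1) lg_T _ that(3,2)] \<rho>' T(1)
    unfolding G_def by auto
  have step_F: "pd j (F n a) x = F (n - 1) (a - int (k j)) x" if "n > 0" "x \<in> U" for n a j x
  proof -
    have "pd j (F n a) x = (\<Sum>i\<in>S. c i * pd j (G i n a) x)"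
      unfolding F_def by (rule pd_sum_cmult[OF shift_familyD(1)[OF shift_G] that(2)])
    also have "\<dots> = F (n - 1) (a - int (k j)) x"
      unfolding F_def by (intro sum.cong refl arg_cong[of _ _ "(*) _"] step_G that)
    finally show ?thesis .
  qed
  obtain u :: "nat ^ 'n::{finite,linorder}" where u: "mat_A k *v (\<chi> j. int (u $ j)) = \<alpha>"
    using \<alpha> unfolding I_A_def by blast
  have \<alpha>_vec: "\<alpha> = vector [\<Sum>j\<in>UNIV. int (u $ j), \<Sum>j\<in>UNIV. int (k j) * int (u $ j)]"
    using u unfolding mat_A_vec_eq_iff by (simp add: vec_eq_iff forall_2)
  have origin: "F 0 0 x = 0" if "x \<in> U" for x
  proof (rule relation_at_origin[where F = F and u = u, OF step_F _ that])
    fix x assume "x \<in> U"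
    then show "F (\<Sum>j\<in>UNIV. int (u $ j)) (\<Sum>j\<in>UNIV. int (k j) * int (u $ j)) x = 0"
      using rel unfolding F_def G_def \<alpha>_vec[symmetric] by blast
  qed
  have "Gcd (range k) = 1" using exponents unfolding exponents_def by blast
  then obtain C where C: "\<And>s. s \<ge> C \<Longrightarrow> s \<in> submonoid (range k)"
    using eventually_in_submonoid by blast
  obtain x where x: "x \<in> U" using \<open>U \<noteq> {}\<close> by blast
  obtain \<delta> where \<delta>: "\<delta> > 0" "\<And>\<zeta>. \<zeta> \<in> ball 0 \<delta> \<Longrightarrow> x + axis j0 \<zeta> \<in> U"
  proof -
    obtain \<delta> where "\<delta> > 0" "ball x \<delta> \<subseteq> U" using open_U x open_contains_ball by blast
    then show ?thesis
      using that[of \<delta>] by (auto simp: subset_iff dist_norm norm_axis)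
  qed
  define R where "R = insert \<rho>' T"
  \<comment> \<open>The coefficient of \<open>\<rho>'\<close> collects the lower integration limits.\<close>
  define b where "b \<rho> = (if \<rho> = \<rho>' then - (\<Sum>\<sigma>\<in>T. c (Some \<sigma>)) else c (Some \<rho>))" for \<rho>
  have R: "finite R" "R \<subseteq> roots_on k U"
    using finite_T T(1) \<rho>' unfolding R_def by auto
  have sum_b: "(\<Sum>\<rho>\<in>R. b \<rho> * h \<rho>) = (\<Sum>\<rho>\<in>T. c (Some \<rho>) * (h \<rho> - h \<rho>'))" for h
  proof -
    have "\<rho>' \<notin> T" using T(2) by blast
    moreover from this have "(\<Sum>\<rho>\<in>T. b \<rho> * h \<rho>) = (\<Sum>\<rho>\<in>T. c (Some \<rho>) * h \<rho>)"
      by (intro sum.cong) (auto simp: b_def)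
    ultimately show ?thesis
      using finite_T by (simp add: R_def b_def right_diff_distrib sum_subtractf sum_distrib_right)
  qed
  \<comment> \<open>Starting at \<open>Suc C\<close> keeps \<open>s > 0\<close>, so that the relation consists of powers without logarithms.\<close>
  have power_sums: "\<exists>p. \<forall>\<zeta>\<in>ball 0 \<delta>. (\<Sum>\<rho>\<in>R. b \<rho> * \<rho> (x + axis j0 \<zeta>) ^ s) = poly p \<zeta>"
    if s: "s \<ge> Suc C" for s
  proof -
    obtain r where "\<And>y. y \<in> U \<Longrightarrow> (pd j0 ^^ r) (F 0 (- int s)) y = 0"
      using relation_along_submonoid[OF shift_F origin C[of s]] s by auto
    then obtain p where p: "\<And>\<zeta>. \<zeta> \<in> ball 0 \<delta> \<Longrightarrow> F 0 (- int s) (x + axis j0 \<zeta>) = poly p \<zeta>"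
      using polynomial_on_line[OF holo_on_imp_sep_holo_on[OF shift_familyD(1)[OF shift_F] open_U] open_U \<delta>(2)]
      by metis
    have "(\<Sum>\<rho>\<in>R. b \<rho> * \<rho> y ^ s) = of_nat s * F 0 (- int s) y" for y
    proof -
      have "F 0 (- int s) y = (\<Sum>\<rho>\<in>T. c (Some \<rho>) * ((\<rho> y ^ s - \<rho>' y ^ s) / of_nat s))"
        unfolding F_def sum_option_family[OF S(1)] G_def using s
        by (simp add: Phi_0 tau_level_0 T_def)
      then show ?thesis
        using s unfolding sum_b by (simp add: sum_distrib_left)
    qed
    then have "\<forall>\<zeta>\<in>ball 0 \<delta>. (\<Sum>\<rho>\<in>R. b \<rho> * \<rho> (x + axis j0 \<zeta>) ^ s) = poly (smult (of_nat s) p) \<zeta>"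
      using p by simp
    then show ?thesis by blast
  qed
  have b_const: "b \<rho> = b \<rho>'" if "\<rho> \<in> R" for \<rho>
    by (rule coefficients_equal[OF conn R \<delta> power_sums that]) (auto simp: R_def)
  have "of_nat (card R) * b \<rho>' = (\<Sum>\<rho>\<in>R. b \<rho>)"
    by (simp add: b_const)
  also have "\<dots> = 0" using sum_b[of "\<lambda>_. 1"] by simp
  finally have "b \<rho>' = 0" using R(1) by (auto simp: R_def)
  have c_Some: "c (Some \<rho>) = 0" if "\<rho> \<in> T" for \<rho>
    using b_const[of \<rho>] \<open>b \<rho>' = 0\<close> T(2)[OF that] that by (simp add: b_def R_def)
  have "F 0 0 x = (if None \<in> S then c None else 0)"
    unfolding F_def sum_option_family[OF S(1)] G_def T_def[symmetric] using c_Some by (simp add: Phi_0)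
  then have c_None: "c None = 0" if "None \<in> S" using origin[OF x] that by simp
  show "\<forall>i\<in>S. c i = 0"
    using G_cases c_Some c_None by blast
qed

end

theorem theorem3p1:
  fixes k :: "'n::{finite,linorder} \<Rightarrow> nat" and d :: nat
    and U :: "(complex ^ 'n::{finite,linorder}) set"
    and \<alpha> :: "int ^ 2"
    and \<rho>' :: "complex ^ 'n::{finite,linorder} \<Rightarrow> complex"
    and lg :: "(complex ^ 'n::{finite,linorder} \<Rightarrow> complex) \<Rightarrow> complex ^ 'n::{finite,linorder} \<Rightarrow> complex"
  assumes "exponents k d"
    and "open U" and "U \<noteq> {}" and "simply_connected U" and "U \<subseteq> - Sigma_set k"
    and "\<alpha> \<in> I_A k"
    and "\<rho>' \<in> roots_on k U"
    and "\<And>\<rho>. \<rho> \<in> roots_on k U - {\<rho>'} \<Longrightarrow> log_branch_on U \<rho>' \<rho> (lg \<rho>)"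
  shows "A_hypergeometric_on k U (\<chi> i. of_int (\<alpha> $ i)) (Phi k \<alpha>) \<and>
         (\<forall>\<rho> \<in> roots_on k U - {\<rho>'}.
           A_hypergeometric_on k U (\<chi> i. of_int (\<alpha> $ i)) (tau k d \<alpha> \<rho>' \<rho> (lg \<rho>))) \<and>
         lin_indep_on U (insert None (Some ` (roots_on k U - {\<rho>'})))
           (\<lambda>i. case i of None \<Rightarrow> Phi k \<alpha> | Some \<rho> \<Rightarrow> tau k d \<alpha> \<rho>' \<rho> (lg \<rho>))"
proof -
  interpret hypergeometric_domain k d U
    using assms by unfold_locales auto
  have \<alpha>: "vector [\<alpha> $ 1, \<alpha> $ 2] = \<alpha>"
    by (simp add: vec_eq_iff forall_2)
  have "A_hypergeometric_on k U (\<chi> i. of_int (\<alpha> $ i)) (Phi k (vector [\<alpha> $ 1, \<alpha> $ 2]))"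
    by (rule A_hypergeometric_onI[OF shift_family_Phi])
      (simp_all add: has_pd_imp_pd[OF has_pd_Phi] Phi_Euler)
  moreover have "A_hypergeometric_on k U (\<chi> i. of_int (\<alpha> $ i)) (tau k d (vector [\<alpha> $ 1, \<alpha> $ 2]) \<rho>' \<rho> (lg \<rho>))"
    if "\<rho> \<in> roots_on k U - {\<rho>'}" for \<rho>
  proof (rule A_hypergeometric_onI)
    have \<rho>: "\<rho> \<in> roots_on k U" and lg: "log_branch_on U \<rho>' \<rho> (lg \<rho>)"
      using that assms(8) by auto
    show "shift_family (\<lambda>a. tau k d (vector [\<alpha> $ 1, a]) \<rho>' \<rho> (lg \<rho>))"
      by (rule shift_family_tau[OF assms(7) \<rho> lg])
  qed (use tau_Euler[OF assms(7) _ assms(8)[OF that]] that in auto)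
  moreover have "lin_indep_on U (insert None (Some ` (roots_on k U - {\<rho>'})))
      (\<lambda>i. case i of None \<Rightarrow> Phi k \<alpha> | Some \<rho> \<Rightarrow> tau k d \<alpha> \<rho>' \<rho> (lg \<rho>))"
    using Phi_tau_linearly_independent[OF simply_connected_imp_connected[OF assms(4)] assms(3,6,7,8)] .
  ultimately show ?thesis unfolding \<alpha> by blast
qed

end
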